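(* For $i=1,2$ let $\lambda_i,\alpha_i,\mu_i\in\mathbb{C}^*$ with $\mu_i\neq 1$, and let $V_i$ be a simple $\mathfrak a$-module in the category $\mathcal C$. Then $$\mathcal{M}\big(V_1,\mu_1,\Omega(\lambda_1,\alpha_1)\big)\cong\mathcal{M}\big(V_2,\mu_2,\Omega(\lambda_2,\alpha_2)\big)$$ as $\mathcal L$-modules if and only if one of the following holds: (a) $(\mu_1,\lambda_1,\alpha_1)=(\mu_2,\lambda_2,\alpha_2)$ and $V_1\cong V_2$ as $\mathfrak a$-modules; (b) $\mu_1=\mu_2^{-1}=\frac{\lambda_2}{\lambda_1}$, and $V_1,V_2$ are highest weight $\mathfrak a$-modules with highest weights $-\alpha_2,-\alpha_1$, respectively.
   Context: $\mathcal L$ is the Virasoro algebra: the complex Lie algebra with basis $\{L_m, C\mid m\in\mathbb{Z}\}$ and brackets $[L_m,L_n]=(n-m)L_{m+n}+\delta_{m+n,0}\frac{m^3-m}{12}C$, $[L_m,C]=0$. $\mathfrak a=\mathrm{span}\{L_i\mid i\ge -1\}$ is a Lie subalgebra of $\mathcal L$. A module $V$ over a Lie algebra $\mathfrak g$ is trivial if $xV=0$ for all $x\in\mathfrak g$, and nontrivial otherwise. $\mathcal C$ is the category of all nontrivial $\mathfrak a$-modules $V$ such that for any $0\ne v\in V$ there exists $r_v\in\mathbb{Z}_+$ with $L_{r_v+i}v=0$ for all $i\ge 1$. A highest weight $\mathfrak a$-module with highest weight $\beta\in\mathbb{C}$ is an $\mathfrak a$-module generated by a nonzero vector $v$ (a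 highest weight vector) with $L_0v=\beta v$ and $L_iv=0$ for all $i\ge 1$. Here $\mathbb{Z}_+$ is the set of nonnegative integers and $\mathbb{C}^*=\mathbb{C}\setminus\{0\}$. For $\mu,\lambda\in\mathbb{C}^*$, $\alpha\in\mathbb{C}$ and $V\in\mathcal C$, $\mathcal{M}\big(V,\mu,\Omega(\lambda,\alpha)\big)$ is the $\mathcal L$-module with underlying space $V\otimes\mathbb{C}[\partial]$ and action $$L_m\big(v\otimes f(\partial)\big)=v\otimes\lambda^m(\partial-m\alpha)f(\partial-m)+\Big(\mu^m\sum_{i\ge 0}\frac{m^i}{i!}L_{i-1}v-L_{-1}v\Big)\otimes\lambda^mf(\partial-m),\qquad C\big(v\otimes f(\partial)\big)=0$$ for $m\in\mathbb{Z}$, $v\in V$, $f(\partial)\in\mathbb{C}[\partial]$. *)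

theory Defs
  imports
    Complex_Main
    "HOL-Library.Poly_Mapping"
    "HOL-Library.Product_Plus"
    "HOL-Library.Groups_Big_Fun"
    "HOL-Computational_Algebra.Polynomial"
begin

section \<open>The Virasoro algebra\<close>

text \<open>A pair \<open>(x, c)\<close> stands for the finite sum of the \<open>x\<^sub>m L\<^sub>m\<close> over all integers \<open>m\<close>, plus \<open>c C\<close>.\<close>

type_synonym vir = "(int \<Rightarrow>\<^sub>0 complex) \<times> complex"

definition vir_scale :: "complex \<Rightarrow> vir \<Rightarrow> vir" where
  "vir_scale a x = (Poly_Mapping.map ((*) a) (fst x), a * snd x)"

definition vir_L :: "int \<Rightarrow> vir" where
  "vir_L m = (Poly_Mapping.single m 1, 0)"

definition vir_C :: vir where
  "vir_C = (0, 1)"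

definition vir_bracket_LL :: "int \<Rightarrow> int \<Rightarrow> vir" where
  "vir_bracket_LL m n = vir_scale (of_int (n - m)) (vir_L (m + n))
     + (if m + n = 0 then vir_scale (of_int (m ^ 3 - m) / 12) vir_C else 0)"

text \<open>The bilinear extension. The central components of \<open>x\<close> and \<open>y\<close> do not contribute.\<close>

definition vir_bracket :: "vir \<Rightarrow> vir \<Rightarrow> vir" where
  "vir_bracket x y = (\<Sum>m \<in> Poly_Mapping.keys (fst x). \<Sum>n \<in> Poly_Mapping.keys (fst y).
     vir_scale (Poly_Mapping.lookup (fst x) m * Poly_Mapping.lookup (fst y) n)
       (vir_bracket_LL m n))"

lemma lookup_map_mult [simp]:
  "Poly_Mapping.lookup (Poly_Mapping.map ((*) (a::complex)) p) k = a * Poly_Mapping.lookup p k"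
  by (cases "Poly_Mapping.lookup p k = 0") (auto simp: Poly_Mapping.map.rep_eq)

lemma vector_space_vir_scale: "vector_space vir_scale"
  by unfold_locales
    (auto simp: vir_scale_def prod_eq_iff lookup_add algebra_simps intro!: poly_mapping_eqI)

lemma vir_bracket_L_L: "vir_bracket (vir_L m) (vir_L n) = vir_bracket_LL m n"
  by (auto simp: vir_bracket_def vir_L_def vector_space.vector_space_assms(4)[OF vector_space_vir_scale])

lemma vir_bracket_C: "vir_bracket vir_C x = 0" "vir_bracket x vir_C = 0"
  by (auto simp: vir_bracket_def vir_C_def)

definition vir_a :: "vir set" where
  "vir_a = module.span vir_scale {vir_L i | i. i \<ge> -1}"

section \<open>Modules over a subalgebra of the Virasoro algebra\<close>

text \<open>A module is given by the scalar multiplication \<open>s\<close> on a type of vectors and an action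
  \<open>\<rho>\<close>, which is only relevant on the subalgebra \<open>g\<close>.\<close>

definition lie_module ::
  "vir set \<Rightarrow> (complex \<Rightarrow> 'v::ab_group_add \<Rightarrow> 'v) \<Rightarrow> (vir \<Rightarrow> 'v \<Rightarrow> 'v) \<Rightarrow> bool" where
  "lie_module g s \<rho> \<longleftrightarrow> vector_space s \<and>
     (\<forall>x\<in>g. Vector_Spaces.linear s s (\<rho> x)) \<and>
     (\<forall>x\<in>g. \<forall>y\<in>g. \<forall>v. \<rho> (x + y) v = \<rho> x v + \<rho> y v) \<and>
     (\<forall>a. \<forall>x\<in>g. \<forall>v. \<rho> (vir_scale a x) v = s a (\<rho> x v)) \<and>
     (\<forall>x\<in>g. \<forall>y\<in>g. \<forall>v. \<rho> (vir_bracket x y) v = \<rho> x (\<rho> y v) - \<rho> y (\<rho> x v))"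

definition lie_submodule ::
  "vir set \<Rightarrow> (complex \<Rightarrow> 'v::ab_group_add \<Rightarrow> 'v) \<Rightarrow> (vir \<Rightarrow> 'v \<Rightarrow> 'v) \<Rightarrow> 'v set \<Rightarrow> bool" where
  "lie_submodule g s \<rho> W \<longleftrightarrow> module.subspace s W \<and> (\<forall>x\<in>g. \<forall>w\<in>W. \<rho> x w \<in> W)"

definition trivial_module ::
  "vir set \<Rightarrow> (vir \<Rightarrow> 'v::ab_group_add \<Rightarrow> 'v) \<Rightarrow> bool" where
  "trivial_module g \<rho> \<longleftrightarrow> (\<forall>x\<in>g. \<forall>v. \<rho> x v = 0)"

definition simple_module ::
  "vir set \<Rightarrow> (complex \<Rightarrow> 'v::ab_group_add \<Rightarrow> 'v) \<Rightarrow> (vir \<Rightarrow> 'v \<Rightarrow> 'v) \<Rightarrow> bool" where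
  "simple_module g s \<rho> \<longleftrightarrow> lie_module g s \<rho> \<and> (\<exists>v::'v. v \<noteq> 0) \<and>
     (\<forall>W. lie_submodule g s \<rho> W \<longrightarrow> W = {0} \<or> W = UNIV)"

definition lie_module_iso ::
  "vir set \<Rightarrow> (complex \<Rightarrow> 'v::ab_group_add \<Rightarrow> 'v) \<Rightarrow> (vir \<Rightarrow> 'v \<Rightarrow> 'v) \<Rightarrow>
     (complex \<Rightarrow> 'w::ab_group_add \<Rightarrow> 'w) \<Rightarrow> (vir \<Rightarrow> 'w \<Rightarrow> 'w) \<Rightarrow> bool" where
  "lie_module_iso g s1 \<rho>1 s2 \<rho>2 \<longleftrightarrow>
     (\<exists>\<phi>. Vector_Spaces.linear s1 s2 \<phi> \<and> bij \<phi> \<and> (\<forall>x\<in>g. \<forall>v. \<phi> (\<rho>1 x v) = \<rho>2 x (\<phi> v)))"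

definition category_C ::
  "(complex \<Rightarrow> 'v::ab_group_add \<Rightarrow> 'v) \<Rightarrow> (vir \<Rightarrow> 'v \<Rightarrow> 'v) \<Rightarrow> bool" where
  "category_C s \<rho> \<longleftrightarrow> lie_module vir_a s \<rho> \<and> \<not> trivial_module vir_a \<rho> \<and>
     (\<forall>v. v \<noteq> 0 \<longrightarrow> (\<exists>r::nat. \<forall>i\<ge>1. \<rho> (vir_L (int r + i)) v = 0))"

definition highest_weight_module ::
  "(complex \<Rightarrow> 'v::ab_group_add \<Rightarrow> 'v) \<Rightarrow> (vir \<Rightarrow> 'v \<Rightarrow> 'v) \<Rightarrow> complex \<Rightarrow> bool" where
  "highest_weight_module s \<rho> \<beta> \<longleftrightarrow> lie_module vir_a s \<rho> \<and>
     (\<exists>v. v \<noteq> 0 \<and> lie_submodule vir_a s \<rho> hull {v} = UNIV \<and>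
        \<rho> (vir_L 0) v = s \<beta> v \<and> (\<forall>i\<ge>1. \<rho> (vir_L i) v = 0))"

section \<open>The modules \<open>M(V, \<mu>, \<Omega>(\<lambda>, \<alpha>))\<close>\<close>

text \<open>The tensor product of \<open>V\<close> and \<open>\<complex>[\<partial>]\<close> is modelled by the polynomials in \<open>\<partial>\<close> with
  coefficients in \<open>V\<close>, where the coefficients of the elementary tensor of \<open>v\<close> and \<open>f\<close> are
  \<open>f\<^sub>k v\<close>.\<close>

definition tensor ::
  "(complex \<Rightarrow> 'v::ab_group_add \<Rightarrow> 'v) \<Rightarrow> 'v \<Rightarrow> complex poly \<Rightarrow> 'v poly" where
  "tensor s v f = map_poly (\<lambda>c. s c v) f"

definition tensor_scale ::
  "(complex \<Rightarrow> 'v::ab_group_add \<Rightarrow> 'v) \<Rightarrow> complex \<Rightarrow> 'v poly \<Rightarrow> 'v poly" where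
  "tensor_scale s a p = map_poly (s a) p"

text \<open>The vector \<open>L\<^sub>m (v \<otimes> f)\<close>. The sum over \<open>i\<close> has finite support for modules in the
  category \<open>\<C>\<close>, and \<open>f(\<partial> - m)\<close> is the composition of \<open>f\<close> with \<open>[:-m, 1:]\<close>.\<close>

definition M_tensor ::
  "(complex \<Rightarrow> 'v::ab_group_add \<Rightarrow> 'v) \<Rightarrow> (vir \<Rightarrow> 'v \<Rightarrow> 'v) \<Rightarrow> complex \<Rightarrow> complex \<Rightarrow> complex \<Rightarrow>
     int \<Rightarrow> 'v \<Rightarrow> complex poly \<Rightarrow> 'v poly" where
  "M_tensor s \<rho> \<mu> l \<alpha> m v f =
     tensor s v (smult (l powi m) ([:- of_int m * \<alpha>, 1:] * pcompose f [:- of_int m, 1:]))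
   + tensor s
       (s (\<mu> powi m) (Sum_any (\<lambda>i::nat. s (of_int m ^ i / fact i) (\<rho> (vir_L (int i - 1)) v)))
          - \<rho> (vir_L (-1)) v)
       (smult (l powi m) (pcompose f [:- of_int m, 1:]))"

definition M_L ::
  "(complex \<Rightarrow> 'v::ab_group_add \<Rightarrow> 'v) \<Rightarrow> (vir \<Rightarrow> 'v \<Rightarrow> 'v) \<Rightarrow> complex \<Rightarrow> complex \<Rightarrow> complex \<Rightarrow>
     int \<Rightarrow> 'v poly \<Rightarrow> 'v poly" where
  "M_L s \<rho> \<mu> l \<alpha> m p = (\<Sum>k\<le>degree p. M_tensor s \<rho> \<mu> l \<alpha> m (coeff p k) (monom 1 k))"

text \<open>The central element \<open>C\<close> acts by \<open>0\<close>.\<close>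

definition M_act ::
  "(complex \<Rightarrow> 'v::ab_group_add \<Rightarrow> 'v) \<Rightarrow> (vir \<Rightarrow> 'v \<Rightarrow> 'v) \<Rightarrow> complex \<Rightarrow> complex \<Rightarrow> complex \<Rightarrow>
     vir \<Rightarrow> 'v poly \<Rightarrow> 'v poly" where
  "M_act s \<rho> \<mu> l \<alpha> x p = (\<Sum>m \<in> Poly_Mapping.keys (fst x).
     tensor_scale s (Poly_Mapping.lookup (fst x) m) (M_L s \<rho> \<mu> l \<alpha> m p))"

text \<open>On elementary tensors, the action is the one in the definition of
  \<open>M(V, \<mu>, \<Omega>(\<lambda>, \<alpha>))\<close>.\<close>

lemma vir_L_in_vir_a: "i \<ge> -1 \<Longrightarrow> vir_L i \<in> vir_a"
proof -
  interpret vector_space vir_scale by (rule vector_space_vir_scale)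
  show "i \<ge> -1 \<Longrightarrow> vir_L i \<in> vir_a" unfolding vir_a_def by (rule span_base) auto
qed

lemma coeff_tensor:
  assumes "vector_space s"
  shows "coeff (tensor s v f) k = s (coeff f k) v"
proof -
  interpret vector_space s by (rule assms)
  show ?thesis by (simp add: tensor_def coeff_map_poly)
qed

lemma coeff_tensor_scale:
  assumes "vector_space s"
  shows "coeff (tensor_scale s a p) k = s a (coeff p k)"
proof -
  interpret vector_space s by (rule assms)
  show ?thesis by (simp add: tensor_scale_def coeff_map_poly)
qed

lemma tensor_bilinear:
  assumes "vector_space s"
  shows "tensor s (v + w) f = tensor s v f + tensor s w f"
    and "tensor s v (f + g) = tensor s v f + tensor s v g"
    and "tensor s (s a v) f = tensor_scale s a (tensor s v f)"
    and "tensor s v (smult a f) = tensor_scale s a (tensor s v f)"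
proof -
  interpret vector_space s by (rule assms)
  show "tensor s (v + w) f = tensor s v f + tensor s w f"
    and "tensor s v (f + g) = tensor s v f + tensor s v g"
    and "tensor s (s a v) f = tensor_scale s a (tensor s v f)"
    and "tensor s v (smult a f) = tensor_scale s a (tensor s v f)"
    by (auto intro!: poly_eqI simp: coeff_tensor[OF assms] coeff_tensor_scale[OF assms]
        scale_left_distrib scale_right_distrib mult.commute)
qed

lemma sum_elementary_tensors:
  assumes "vector_space s"
  shows "p = (\<Sum>k\<le>degree p. tensor s (coeff p k) (monom 1 k))"
proof -
  interpret vector_space s by (rule assms)
  have "tensor s (coeff p k) (monom 1 k) = monom (coeff p k) k" for k
    by (intro poly_eqI) (simp add: coeff_tensor[OF assms])
  then show ?thesis by (simp add: poly_as_sum_of_monoms)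
qed

lemma M_tensor_add_right:
  assumes "vector_space s"
  shows "M_tensor s \<rho> \<mu> l \<alpha> m v (f + g) = M_tensor s \<rho> \<mu> l \<alpha> m v f + M_tensor s \<rho> \<mu> l \<alpha> m v g"
  by (simp only: M_tensor_def pcompose_add distrib_left smult_add_right
      tensor_bilinear[OF assms] ac_simps)

lemma M_tensor_scale_left:
  assumes "lie_module vir_a s \<rho>"
  shows "M_tensor s \<rho> \<mu> l \<alpha> m (s c v) f = M_tensor s \<rho> \<mu> l \<alpha> m v (smult c f)"
proof -
  have vs: "vector_space s" using assms by (simp add: lie_module_def)
  interpret vector_space s by (rule vs)
  have lin: "\<rho> (vir_L i) (s c u) = s c (\<rho> (vir_L i) u)" if "i \<ge> -1" for i u
    using assms vir_L_in_vir_a[OF that]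
    by (metis lie_module_def Vector_Spaces.linear_iff_module_hom module_hom.scale)
  have sum: "Sum_any (\<lambda>i::nat. s (b i) (s c (h i))) = s c (Sum_any (\<lambda>i. s (b i) (h i)))"
    for b :: "nat \<Rightarrow> complex" and h
  proof (cases "c = 0")
    case False
    then have "{i. s (b i) (s c (h i)) \<noteq> 0} = {i. s (b i) (h i) \<noteq> 0}" by auto
    then show ?thesis
      unfolding Sum_any.expand_set by (auto simp: scale_sum_right mult.commute intro!: sum.cong)
  qed simp
  define S where "S u = Sum_any (\<lambda>i::nat. s (of_int m ^ i / fact i) (\<rho> (vir_L (int i - 1)) u))" for u
  have "S (s c v) = s c (S v)"
    unfolding S_def by (subst lin, simp, rule sum)
  then show ?thesis
    unfolding M_tensor_def S_def[symmetric]
    by (intro poly_eqI)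
      (simp add: lin pcompose_smult coeff_tensor[OF vs] scale_right_diff_distrib
        scale_right_distrib right_diff_distrib ac_simps)
qed

lemma M_L_tensor:
  assumes "lie_module vir_a s \<rho>"
  shows "M_L s \<rho> \<mu> l \<alpha> m (tensor s v f) = M_tensor s \<rho> \<mu> l \<alpha> m v f"
proof -
  have vs: "vector_space s" using assms by (simp add: lie_module_def)
  interpret vector_space s by (rule vs)
  let ?T = "M_tensor s \<rho> \<mu> l \<alpha> m"
  have t0: "?T v 0 = 0"
    by (simp add: M_tensor_def tensor_def)
  have "M_L s \<rho> \<mu> l \<alpha> m (tensor s v f)
      = (\<Sum>k\<le>degree (tensor s v f). ?T v (smult (coeff f k) (monom 1 k)))"
    by (simp only: M_L_def coeff_tensor[OF vs] M_tensor_scale_left[OF assms])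
  also have "\<dots> = (\<Sum>k\<le>degree f. ?T v (smult (coeff f k) (monom 1 k)))"
  proof (rule sum.mono_neutral_left)
    show "{..degree (tensor s v f)} \<subseteq> {..degree f}"
      using degree_le[of "degree f" "tensor s v f"]
      by (auto simp: coeff_tensor[OF vs] coeff_eq_0)
    show "\<forall>k\<in>{..degree f} - {..degree (tensor s v f)}.
        ?T v (smult (coeff f k) (monom 1 k)) = 0"
    proof
      fix k assume "k \<in> {..degree f} - {..degree (tensor s v f)}"
      then have "coeff (tensor s v f) k = 0" by (intro coeff_eq_0) simp
      then have "s (coeff f k) v = 0" by (simp add: coeff_tensor[OF vs])
      then have "coeff f k = 0 \<or> v = 0" by simp
      then show "?T v (smult (coeff f k) (monom 1 k)) = 0"
      proof
        assume "v = 0"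
        then show ?thesis
          using M_tensor_scale_left[OF assms, of \<mu> l \<alpha> m 0 0 "smult (coeff f k) (monom 1 k)"] t0
          by simp
      qed (simp add: t0)
    qed
  qed simp
  also have "\<dots> = ?T v (\<Sum>k\<le>degree f. smult (coeff f k) (monom 1 k))"
    by (rule sum_comp_morphism[unfolded o_def])
      (simp_all add: t0 M_tensor_add_right[OF vs])
  also have "(\<Sum>k\<le>degree f. smult (coeff f k) (monom 1 k)) = f"
    by (simp add: smult_monom poly_as_sum_of_monoms)
  finally show ?thesis .
qed

lemma M_act_tensor:
  assumes "lie_module vir_a s \<rho>"
  shows "M_act s \<rho> \<mu> l \<alpha> (vir_L m) (tensor s v f) = M_tensor s \<rho> \<mu> l \<alpha> m v f"
    and "M_act s \<rho> \<mu> l \<alpha> vir_C (tensor s v f) = 0"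
proof -
  have vs: "vector_space s" using assms by (simp add: lie_module_def)
  interpret vector_space s by (rule vs)
  have "tensor_scale s 1 p = p" for p
    by (intro poly_eqI) (simp add: coeff_tensor_scale[OF vs])
  then show "M_act s \<rho> \<mu> l \<alpha> (vir_L m) (tensor s v f) = M_tensor s \<rho> \<mu> l \<alpha> m v f"
    by (simp add: M_act_def vir_L_def M_L_tensor[OF assms])
  show "M_act s \<rho> \<mu> l \<alpha> vir_C (tensor s v f) = 0"
    by (simp add: M_act_def vir_C_def)
qed

end

theory Submission
  imports Defs "HOL-Computational_Algebra.Fundamental_Theorem_Algebra"
begin

text \<open>On a fixed vector, \<open>L\<^sub>m\<close> acts as \<open>\<lambda>\<^sup>m P(m) + (\<lambda>\<mu>)\<^sup>m Q(m)\<close> with \<open>P\<close> and \<open>Q\<close> polynomial in \<open>m\<close>. As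
  exponentials with different bases are independent over polynomials, an isomorphism either matches
  the two parts of both modules or swaps them. It is applied to \<open>u = v \<otimes> 1\<close>, for which \<open>P\<close> is affine
  in \<open>m\<close> with slope \<open>-\<alpha>\<^sub>1 u\<close>. If the parts are matched, then this forces the image of \<open>u\<close> to have degree
  \<open>0\<close> in \<open>\<partial>\<close>, as \<open>\<alpha>\<^sub>2 \<noteq> 0\<close>, and the isomorphism restricts to \<open>V\<^sub>1 \<rightarrow> V\<^sub>2\<close>. If they are swapped, then
  the leading coefficient of the image is a highest weight vector of weight \<open>-\<alpha>\<^sub>1\<close>.

  Conversely, a simple highest weight module of weight \<open>\<beta> \<noteq> 0\<close> is \<open>\<complex>[x]\<close> with \<open>L\<^sub>-\<^sub>1 = x\<close>, and
  the sum of the \<open>(m\<^sup>i / i!) L\<^sub>i\<^sub>-\<^sub>1\<close> maps \<open>f(x)\<close> to \<open>(x + m\<beta>) f(x - m)\<close>. Then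
  \<open>F(x, \<partial>) \<mapsto> F(\<partial> - x, \<partial>)\<close> is the isomorphism in case (b).\<close>

subsection \<open>Exponential polynomials\<close>

lemma degree_poly_shift_diff_less:
  fixes p :: "complex poly"
  assumes "degree p \<noteq> 0"
  shows "degree (pcompose p [:1, 1:] - p) < degree p"
proof -
  have d: "degree (pcompose p [:1, 1:]) = degree p"
    by (simp add: degree_pcompose)
  have "lead_coeff (pcompose p [:1, 1:]) = lead_coeff p"
    by (subst lead_coeff_comp) auto
  then have "coeff (pcompose p [:1, 1:] - p) (degree p) = 0"
    using d by simp
  moreover have "degree (pcompose p [:1, 1:] - p) \<le> degree p"
    by (rule degree_diff_le) (simp_all add: d)
  ultimately show ?thesis
    using assms by (metis degree_0 leading_coeff_0_iff le_neq_implies_less)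
qed

lemma poly_eq_0_if_zero_on_nats:
  fixes p :: "complex poly"
  assumes "\<And>n::nat. poly p (of_nat n) = 0"
  shows "p = 0"
proof (rule ccontr)
  assume "p \<noteq> 0"
  then have "finite {x. poly p x = 0}" by (rule poly_roots_finite)
  moreover have "range (of_nat :: nat \<Rightarrow> complex) \<subseteq> {x. poly p x = 0}" using assms by auto
  ultimately have "finite (range (of_nat :: nat \<Rightarrow> complex))" by (rule rev_finite_subset)
  then show False using finite_imageD[OF _ inj_of_nat] by auto
qed

text \<open>Outer induction on the set of bases, inner induction on the degree at the new base
  \<open>b\<close>: passing from \<open>F n\<close> to \<open>F (Suc n) - b * F n\<close> lowers the
  degree of the polynomial at \<open>b\<close> and keeps the degrees at the other bases.\<close>

lemma exponential_polynomials_independent: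
  fixes P :: "complex \<Rightarrow> complex poly"
  assumes "finite A" "0 \<notin> A" "\<And>n::nat. (\<Sum>a\<in>A. a ^ n * poly (P a) (of_nat n)) = 0"
    and "a \<in> A"
  shows "P a = 0"
  using assms
proof (induction A arbitrary: P a rule: finite_induct)
  case empty
  then show ?case by simp
next
  case (insert b A)
  have b0: "b \<noteq> 0" and A0: "0 \<notin> A" using insert.prems by auto
  have zero_if_bounded: "\<forall>a\<in>insert b A. P a = 0"
    if "\<And>n::nat. (\<Sum>a\<in>A. a ^ n * poly (P a) (of_nat n)) + b ^ n * poly (P b) (of_nat n) = 0"
      and "P b = 0 \<or> degree (P b) < N" for P N
    using that
  proof (induction N arbitrary: P)
    case 0
    then show ?case using insert.IH[OF A0, of P] by auto
  next
    case (Suc N)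
    define R where "R a = smult a (pcompose (P a) [:1, 1:]) - smult b (P a)" for a
    have pR: "poly (R a) x = a * poly (P a) (1 + x) - b * poly (P a) x" for a x
      by (simp add: R_def poly_pcompose)
    have Rb: "R b = smult b (pcompose (P b) [:1, 1:] - P b)"
      by (simp add: R_def smult_diff_right)
    have zero: "(\<Sum>a\<in>A. a ^ n * poly (R a) (of_nat n)) + b ^ n * poly (R b) (of_nat n) = 0" for n
    proof -
      let ?F = "\<lambda>n. (\<Sum>a\<in>A. a ^ n * poly (P a) (of_nat n)) + b ^ n * poly (P b) (of_nat n)"
      have "(\<Sum>a\<in>A. a ^ n * poly (R a) (of_nat n)) + b ^ n * poly (R b) (of_nat n)
          = ?F (Suc n) - b * ?F n"
        by (simp add: pR sum_subtractf sum_distrib_left algebra_simps)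
      then show ?thesis using Suc.prems(1)[of "Suc n"] Suc.prems(1)[of n] by simp
    qed
    have "R b = 0 \<or> degree (R b) < N"
    proof (cases "degree (P b) = 0")
      case True
      then obtain c where "P b = [:c:]" by (auto elim: degree_eq_zeroE)
      then show ?thesis by (simp add: Rb)
    next
      case False
      have "degree (R b) < degree (P b)"
        using degree_poly_shift_diff_less[OF False] b0 by (simp add: Rb)
      then show ?thesis using Suc.prems(2) False by auto
    qed
    from Suc.IH[OF zero this] have R0: "R a = 0" if "a \<in> insert b A" for a using that by auto
    \<comment> \<open>The leading coefficient of \<open>P a\<close> survives in \<open>R a\<close>
      with the factor \<open>a - b\<close>, which is nonzero.\<close>
    have PA: "P a = 0" if "a \<in> A" for a
    proof (rule ccontr)
      assume "P a \<noteq> 0"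
      have d: "degree (pcompose (P a) [:1, 1:]) = degree (P a)" by (simp add: degree_pcompose)
      have lc: "lead_coeff (pcompose (P a) [:1, 1:]) = lead_coeff (P a)"
        by (subst lead_coeff_comp) auto
      have "coeff (R a) (degree (P a)) = (a - b) * lead_coeff (P a)"
        using lc d by (simp add: R_def algebra_simps)
      moreover have "a \<noteq> b" using that insert.hyps by auto
      ultimately show False using R0[of a] that \<open>P a \<noteq> 0\<close> by simp
    qed
    then have "b ^ n * poly (P b) (of_nat n) = 0" for n using Suc.prems(1)[of n] by simp
    then have "P b = 0" using b0 by (intro poly_eq_0_if_zero_on_nats) auto
    then show ?case using PA by auto
  qed
  have "\<forall>a\<in>insert b A. P a = 0"
  proof (rule zero_if_bounded)
    show "(\<Sum>a\<in>A. a ^ n * poly (P a) (of_nat n)) + b ^ n * poly (P b) (of_nat n) = 0" for n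
      using insert.prems(2)[of n] insert.hyps by (simp add: add.commute)
    show "P b = 0 \<or> degree (P b) < Suc (degree (P b))" by simp
  qed
  then show ?case using insert.prems by auto
qed

section \<open>Vector-valued exponential polynomials\<close>

lemma exists_functional_nonzero:
  assumes "vector_space s" "v \<noteq> 0"
  shows "\<exists>f. Vector_Spaces.linear s ((*) :: complex \<Rightarrow> _) f \<and> f v \<noteq> 0"
proof -
  interpret vector_space_pair s "(*) :: complex \<Rightarrow> _"
    using assms by (intro vector_space_pair.intro) (simp_all add: vector_space_def algebra_simps)
  have "vs1.independent {v}" using assms(2) by (simp add: vs1.dependent_single)
  then obtain g where "Vector_Spaces.linear s (*) g" "\<forall>x\<in>{v}. g x = 1"
    using linear_independent_extend[of "{v}" "\<lambda>_. 1"] by blast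
  then show ?thesis by (intro exI[of _ g]) auto
qed

text \<open>Vector-valued polynomials in an integer \<open>m\<close>, given by closure rules: linear
  and bilinear maps preserve them by rule induction, without bookkeeping of coefficients or
  degrees.\<close>

inductive polyfun :: "(complex \<Rightarrow> 'v::ab_group_add \<Rightarrow> 'v) \<Rightarrow> (int \<Rightarrow> 'v) \<Rightarrow> bool" for s where
  const: "polyfun s (\<lambda>m. c)"
| add: "polyfun s f \<Longrightarrow> polyfun s g \<Longrightarrow> polyfun s (\<lambda>m. f m + g m)"
| mult: "polyfun s f \<Longrightarrow> polyfun s (\<lambda>m. s (of_int m) (f m))"

lemma polyfun_linear:
  assumes "Vector_Spaces.linear s t \<phi>" "polyfun s f"
  shows "polyfun t (\<lambda>m. \<phi> (f m))"
  using assms(2)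
proof (induction rule: polyfun.induct)
  case (const c)
  then show ?case by (rule polyfun.const)
next
  case (add f1 f2)
  then show ?case using assms(1) polyfun.add[OF add.IH] by (simp add: Vector_Spaces.linear_iff)
next
  case (mult f1)
  then show ?case using assms(1) polyfun.mult[OF mult.IH] by (simp add: Vector_Spaces.linear_iff)
qed

lemma polyfun_bilinear:
  assumes "\<And>v. Vector_Spaces.linear s t (\<lambda>u. B u v)" "\<And>u. Vector_Spaces.linear r t (B u)"
    and "polyfun s f" "polyfun r g"
  shows "polyfun t (\<lambda>m. B (f m) (g m))"
  using assms(3)
proof (induction rule: polyfun.induct)
  case (const c)
  then show ?case using polyfun_linear[OF assms(2) assms(4)] .
next
  case (add f1 f2)
  then show ?case using assms(1) polyfun.add[OF add.IH] by (simp add: Vector_Spaces.linear_iff)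
next
  case (mult f1)
  then show ?case using assms(1) polyfun.mult[OF mult.IH] by (simp add: Vector_Spaces.linear_iff)
qed

lemma polyfun_sum:
  assumes "\<And>k. k \<in> K \<Longrightarrow> polyfun s (f k)"
  shows "polyfun s (\<lambda>m. \<Sum>k\<in>K. f k m)"
  using assms
proof (induction K rule: infinite_finite_induct)
  case (insert k K)
  then show ?case by (simp add: polyfun.add)
qed (simp_all add: polyfun.const)

lemma polyfun_scale:
  assumes "vector_space s" "polyfun s f"
  shows "polyfun s (\<lambda>m. s c (f m))"
proof -
  interpret vector_space s by (rule assms)
  have "Vector_Spaces.linear s s (s c)"
    by (simp add: Vector_Spaces.linear_iff assms(1) scale_right_distrib mult.commute)
  then show ?thesis using assms(2) by (rule polyfun_linear)
qed

lemma polyfun_diff: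
  assumes "vector_space s" "polyfun s f" "polyfun s g"
  shows "polyfun s (\<lambda>m. f m - g m)"
proof -
  interpret vector_space s by (rule assms)
  show ?thesis using polyfun.add[OF assms(2) polyfun_scale[OF assms(1,3), of "-1"]] by simp
qed

lemma polyfun_power:
  assumes "vector_space s"
  shows "polyfun s (\<lambda>m. s (of_int m ^ i) c)"
proof -
  interpret vector_space s by (rule assms)
  show ?thesis
  proof (induction i)
    case 0
    show ?case by (simp add: polyfun.const)
  next
    case (Suc i)
    show ?case using polyfun.mult[OF Suc] by simp
  qed
qed

lemma polyfun_complex:
  assumes "polyfun (*) f"
  shows "\<exists>p. \<forall>m. f m = poly p (of_int m)"
  using assms
proof (induction rule: polyfun.induct)
  case (const c)
  show ?case by (rule exI[of _ "[:c:]"]) simp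
next
  case (add f g)
  then obtain p q where "\<forall>m. f m = poly p (of_int m)" "\<forall>m. g m = poly q (of_int m)" by auto
  then show ?case by (intro exI[of _ "p + q"]) simp
next
  case (mult f)
  then obtain p where "\<forall>m. f m = poly p (of_int m)" by auto
  then show ?case by (intro exI[of _ "pCons 0 p"]) simp
qed

text \<open>A linear functional that is nonzero at an offending value turns the identity into one
  between scalar exponential polynomials at natural arguments.\<close>

lemma exponential_polyfuns_independent:
  assumes vs: "vector_space s" and A: "finite A" "0 \<notin> A" and poly: "\<And>a. a \<in> A \<Longrightarrow> polyfun s (P a)"
    and sum0: "\<And>m::int. (\<Sum>a\<in>A. s (a powi m) (P a m)) = 0"
    and a: "a \<in> A"
  shows "P a m = 0"
proof (rule ccontr)
  assume "P a m \<noteq> 0"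
  then obtain f where f: "Vector_Spaces.linear s (*) f" "f (P a m) \<noteq> 0"
    using exists_functional_nonzero[OF vs] by blast
  interpret Vector_Spaces.linear s "(*)" f by (rule f)
  have "\<exists>p. \<forall>m. f (P a m) = poly p (of_int m)" if "a \<in> A" for a
    by (rule polyfun_complex[OF polyfun_linear[OF f(1) poly[OF that]]])
  then obtain p where p: "\<And>a m. a \<in> A \<Longrightarrow> f (P a m) = poly (p a) (of_int m)" by metis
  have "p a = 0"
  proof (rule exponential_polynomials_independent[OF A _ a])
    fix n :: nat
    have "0 = f (\<Sum>a\<in>A. s (a powi int n) (P a (int n)))" using sum0[of "int n"] by (simp add: zero)
    also have "\<dots> = (\<Sum>a\<in>A. a ^ n * poly (p a) (of_nat n))"
      by (simp add: sum scale p)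
    finally show "(\<Sum>a\<in>A. a ^ n * poly (p a) (of_nat n)) = 0" by simp
  qed
  then show False using f(2) p[OF a] by simp
qed

lemma power_sum_eq_0_imp_coeffs_0:
  fixes s :: "complex \<Rightarrow> 'v::ab_group_add \<Rightarrow> 'v"
  assumes vs: "vector_space s"
    and sum0: "\<And>m::int. (\<Sum>k\<le>n. s (of_int m ^ k) (c k)) = 0" and k: "k \<le> n"
  shows "c k = 0"
proof (rule ccontr)
  assume "c k \<noteq> 0"
  then obtain f where f: "Vector_Spaces.linear s (*) f" "f (c k) \<noteq> 0"
    using exists_functional_nonzero[OF vs] by blast
  interpret Vector_Spaces.linear s "(*)" f by (rule f)
  define p where "p = (\<Sum>k\<le>n. monom (f (c k)) k)"
  have "poly p (of_int m) = f (\<Sum>k\<le>n. s (of_int m ^ k) (c k))" for m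
    by (simp add: p_def poly_sum poly_monom sum scale mult.commute)
  then have "poly p (of_int m) = 0" for m using sum0 by (simp add: zero)
  from this[of "int _"] have "p = 0" by (intro poly_eq_0_if_zero_on_nats) simp
  moreover have "coeff p k = f (c k)"
    using k by (simp add: p_def coeff_sum)
  ultimately show False using f(2) by simp
qed

lemma two_exponentials:
  assumes vs: "vector_space s" and nz: "a \<noteq> 0" "b \<noteq> 0" "c \<noteq> 0" "d \<noteq> 0" and "a \<noteq> b" "c \<noteq> d"
    and poly: "polyfun s P" "polyfun s Q" "polyfun s P'" "polyfun s Q'"
    and eq: "\<And>m. s (a powi m) (P m) + s (b powi m) (Q m)
                = s (c powi m) (P' m) + s (d powi m) (Q' m)"
  shows "a = c \<Longrightarrow> b = d \<Longrightarrow> P m = P' m \<and> Q m = Q' m"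
    and "a = d \<Longrightarrow> b = c \<Longrightarrow> P m = Q' m \<and> Q m = P' m"
    and "a \<noteq> c \<Longrightarrow> a \<noteq> d \<Longrightarrow> P m = 0"
    and "b \<noteq> c \<Longrightarrow> b \<noteq> d \<Longrightarrow> Q m = 0"
proof -
  interpret vector_space s by (rule vs)
  \<comment> \<open>Bases of the two sides may coincide, so terms are collected by base:
    \<open>F x\<close> is the total coefficient of \<open>x powi m\<close>, and the sum runs over
    the set \<open>{a, b, c, d}\<close>, whatever its cardinality.\<close>
  define F where "F x m = (if x = a then P m else 0) + (if x = b then Q m else 0)
      - ((if x = c then P' m else 0) + (if x = d then Q' m else 0))" for x m
  have if_poly: "polyfun s (\<lambda>m. if B then g m else 0)" if "polyfun s g" for B g
    using that by (cases B) (simp_all add: polyfun.const)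
  have F0: "F x m = 0" if "x \<in> {a, b, c, d}" for x
  proof (rule exponential_polyfuns_independent[OF vs _ _ _ _ that])
    show "polyfun s (F x)" for x
      unfolding F_def
      using poly by (intro polyfun_diff[OF vs] polyfun.add if_poly)
    show "(\<Sum>x\<in>{a, b, c, d}. s (x powi m) (F x m)) = 0" for m
    proof -
      have *: "(\<Sum>x\<in>{a, b, c, d}. s (x powi m) (if x = y then R else 0)) = s (y powi m) R"
        if "y \<in> {a, b, c, d}" for y R
      proof -
        have "(\<Sum>x\<in>{a, b, c, d}. s (x powi m) (if x = y then R else 0))
          = (\<Sum>x\<in>{a, b, c, d}. if x = y then s (y powi m) R else 0)"
          by (rule sum.cong) auto
        also have "\<dots> = s (y powi m) R" using that by (subst sum.delta) auto
        finally show ?thesis .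
      qed
      have "(\<Sum>x\<in>{a, b, c, d}. s (x powi m) (F x m))
          = s (a powi m) (P m) + s (b powi m) (Q m)
            - (s (c powi m) (P' m) + s (d powi m) (Q' m))"
        unfolding F_def scale_right_distrib scale_right_diff_distrib sum.distrib sum_subtractf
        using *[of a "P m"] *[of b "Q m"] *[of c "P' m"] *[of d "Q' m"]
        by (simp only: insert_iff simp_thms)
      then show ?thesis using eq[of m] by simp
    qed
  qed (use nz in auto)
  from F0[of a] F0[of b] assms(6,7)
  show "a = c \<Longrightarrow> b = d \<Longrightarrow> P m = P' m \<and> Q m = Q' m"
    and "a = d \<Longrightarrow> b = c \<Longrightarrow> P m = Q' m \<and> Q m = P' m"
    and "a \<noteq> c \<Longrightarrow> a \<noteq> d \<Longrightarrow> P m = 0"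
    and "b \<noteq> c \<Longrightarrow> b \<noteq> d \<Longrightarrow> Q m = 0"
    by (auto simp: F_def)
qed

subsection \<open>Modules over \<open>vir_a\<close>\<close>

lemma vector_space_tensor_scale: "vector_space s \<Longrightarrow> vector_space (tensor_scale s)"
  by (simp add: vector_space_def poly_eq_iff coeff_tensor_scale)

lemma vir_a_induct [consumes 1, case_names zero L add scale]:
  assumes "x \<in> vir_a" "P 0" "\<And>i. i \<ge> -1 \<Longrightarrow> P (vir_L i)"
    and "\<And>x y. x \<in> vir_a \<Longrightarrow> y \<in> vir_a \<Longrightarrow> P x \<Longrightarrow> P y \<Longrightarrow> P (x + y)"
    and "\<And>c x. x \<in> vir_a \<Longrightarrow> P x \<Longrightarrow> P (vir_scale c x)"
  shows "P x"
proof -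
  interpret vector_space vir_scale by (rule vector_space_vir_scale)
  \<comment> \<open>Membership is carried along because the hypotheses on sums and multiples ask for
    it.\<close>
  have "x \<in> vir_a \<and> P x"
    using assms(1)[unfolded vir_a_def]
  proof (induction rule: span_induct)
    case base
    show ?case
      unfolding vir_a_def
      by (intro subspaceI CollectI conjI assms(2,4,5)[unfolded vir_a_def] span_zero span_add
          span_scale) simp_all
  next
    case (step x)
    then show ?case using assms(3) vir_L_in_vir_a by auto
  qed
  then show ?thesis ..
qed

text \<open>With \<open>L_i\<close> read as \<open>t^(i+1) d/dt\<close>, this series is formally
  \<open>e^(mt) d/dt\<close>.\<close>

definition gen_action :: "(complex \<Rightarrow> 'v::ab_group_add \<Rightarrow> 'v) \<Rightarrow> (vir \<Rightarrow> 'v \<Rightarrow> 'v) \<Rightarrow> int \<Rightarrow> 'v \<Rightarrow> 'v"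
  where "gen_action s \<rho> m v =
    Sum_any (\<lambda>i::nat. s (of_int m ^ i / fact i) (\<rho> (vir_L (int i - 1)) v))"

locale C_module =
  fixes s :: "complex \<Rightarrow> 'v::ab_group_add \<Rightarrow> 'v" and \<rho> :: "vir \<Rightarrow> 'v \<Rightarrow> 'v"
  assumes category: "category_C s \<rho>"
begin

lemma lie_module: "lie_module vir_a s \<rho>"
  using category by (simp add: category_C_def)

sublocale vector_space s
  using lie_module by (simp add: lie_module_def)

abbreviation L :: "int \<Rightarrow> 'v \<Rightarrow> 'v" where "L i \<equiv> \<rho> (vir_L i)"

lemma linear_action: "x \<in> vir_a \<Longrightarrow> Vector_Spaces.linear s s (\<rho> x)"
  using lie_module by (simp add: lie_module_def)

lemma action_add: "x \<in> vir_a \<Longrightarrow> y \<in> vir_a \<Longrightarrow> \<rho> (x + y) v = \<rho> x v + \<rho> y v"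
  using lie_module by (simp add: lie_module_def)

lemma action_scale: "x \<in> vir_a \<Longrightarrow> \<rho> (vir_scale c x) v = s c (\<rho> x v)"
  using lie_module by (simp add: lie_module_def)

lemma action_zero: "\<rho> 0 v = 0"
proof -
  have "vir_scale 0 (vir_L 0) = 0"
    using vector_space_vir_scale by (simp add: module.scale_zero_left vector_space_def module_def)
  then show ?thesis using action_scale[OF vir_L_in_vir_a, of 0 0 v] by simp
qed

lemma L_add: "i \<ge> -1 \<Longrightarrow> L i (v + w) = L i v + L i w"
  and L_scale: "i \<ge> -1 \<Longrightarrow> L i (s c v) = s c (L i v)"
  using linear_action[OF vir_L_in_vir_a] by (simp_all add: Vector_Spaces.linear_iff)

lemma L_zero: "i \<ge> -1 \<Longrightarrow> L i 0 = 0"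
  using L_scale[of i 0 0] by simp

text \<open>The central term drops out: for \<open>i + j = 0\<close> the bounds leave only
  \<open>i\<close> in \<open>{-1, 0, 1}\<close>, where \<open>i ^ 3 - i\<close> vanishes.\<close>

lemma L_commute:
  assumes "i \<ge> -1" "j \<ge> -1" "i + j \<ge> -1"
  shows "L i (L j v) = L j (L i v) + s (of_int (j - i)) (L (i + j) v)"
proof -
  interpret vir: vector_space vir_scale by (rule vector_space_vir_scale)
  have central: "i ^ 3 - i = 0" if "i + j = 0"
  proof -
    have "i \<in> {-1, 0, 1}" using that assms by auto
    then show ?thesis by auto
  qed
  have "vir_bracket (vir_L i) (vir_L j) = vir_scale (of_int (j - i)) (vir_L (i + j))"
    using central by (simp add: vir_bracket_L_L vir_bracket_LL_def)
  moreover have "\<rho> (vir_bracket (vir_L i) (vir_L j)) v = L i (L j v) - L j (L i v)"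
    using lie_module vir_L_in_vir_a assms by (simp add: lie_module_def)
  ultimately have "L i (L j v) - L j (L i v) = s (of_int (j - i)) (L (i + j) v)"
    using action_scale[OF vir_L_in_vir_a[OF assms(3)], of "of_int (j - i)" v] by (simp only:)
  then show ?thesis by (simp only: diff_eq_eq add.commute)
qed

lemma L_eventually_zero: "\<exists>r::nat. \<forall>i\<ge>int r. L i v = 0"
proof (cases "v = 0")
  case True
  then show ?thesis using L_zero by (intro exI[of _ 0]) auto
next
  case False
  then obtain r where r: "\<forall>i\<ge>1. L (int r + i) v = 0"
    using category by (auto simp: category_C_def)
  have "L i v = 0" if "i \<ge> int (r + 1)" for i
    using r[rule_format, of "i - int r"] that by simp
  then show ?thesis by blast
qed

lemma gen_action_sum:
  assumes "\<And>i. i \<ge> N \<Longrightarrow> L (int i - 1) v = 0"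
  shows "gen_action s \<rho> m v = (\<Sum>i<N. s (of_int m ^ i / fact i) (L (int i - 1) v))"
  unfolding gen_action_def
proof (rule Sum_any.expand_superset)
  have "s (of_int m ^ i / fact i) (L (int i - 1) v) = 0" if "i \<notin> {..<N}" for i
    using assms[of i] that by (simp only: lessThan_iff not_less scale_zero_right)
  then show "{i. s (of_int m ^ i / fact i) (L (int i - 1) v) \<noteq> 0} \<subseteq> {..<N}" by blast
qed (rule finite_lessThan)

text \<open>The bound \<open>r\<close> depends on \<open>v\<close> only. Serving all
  \<open>m\<close>, it makes the sum a polynomial in \<open>m\<close>; serving all larger
  \<open>N\<close>, it allows two truncations to be brought to equal length.\<close>

lemma gen_action_eq_sum:
  obtains r where "\<forall>N\<ge>r. \<forall>m.
    gen_action s \<rho> m v = (\<Sum>i<N. s (of_int m ^ i / fact i) (L (int i - 1) v))"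
proof -
  obtain r :: nat where r: "\<forall>i\<ge>int r. L i v = 0" using L_eventually_zero by blast
  show thesis
  proof (rule that, intro allI impI, rule gen_action_sum)
    fix N i assume "r + 1 \<le> N" "N \<le> i"
    then show "L (int i - 1) v = 0" using r by simp
  qed
qed

lemma gen_action_0: "gen_action s \<rho> 0 v = L (-1) v"
proof -
  obtain r where r: "\<forall>N\<ge>r. \<forall>m.
      gen_action s \<rho> m v = (\<Sum>i<N. s (of_int m ^ i / fact i) (L (int i - 1) v))"
    by (rule gen_action_eq_sum[of v])
  have "gen_action s \<rho> 0 v = (\<Sum>i<Suc r. s (of_int 0 ^ i / fact i) (L (int i - 1) v))"
    by (rule r[rule_format]) simp
  also have "\<dots> = L (-1) v"
    by (simp add: sum.lessThan_Suc_shift del: sum.lessThan_Suc)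
  finally show ?thesis .
qed

lemma polyfun_gen_action: "polyfun s (\<lambda>m. gen_action s \<rho> m v)"
proof -
  obtain r where r: "\<forall>N\<ge>r. \<forall>m.
      gen_action s \<rho> m v = (\<Sum>i<N. s (of_int m ^ i / fact i) (L (int i - 1) v))"
    by (rule gen_action_eq_sum[of v])
  have "polyfun s (\<lambda>m. s (of_int m ^ i / fact i) (L (int i - 1) v))" for i
    using polyfun_scale[OF vector_space_axioms polyfun_power[OF vector_space_axioms],
        of "1 / fact i" i "L (int i - 1) v"] by simp
  then show ?thesis unfolding r[rule_format, OF order_refl] by (rule polyfun_sum)
qed

text \<open>Comparing the coefficients of the powers of \<open>m\<close> turns an identity for the
  whole series into one for each single \<open>L i\<close>.\<close>

lemma gen_action_unique:
  assumes eq: "\<And>m. gen_action s \<rho> m v = (\<Sum>i<N. s (of_int m ^ i / fact i) (c i))"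
    and c: "\<And>i. i \<ge> N \<Longrightarrow> c i = 0"
  shows "L (int i - 1) v = c i"
proof -
  obtain r where r: "\<forall>N\<ge>r. \<forall>m.
      gen_action s \<rho> m v = (\<Sum>i<N. s (of_int m ^ i / fact i) (L (int i - 1) v))"
    by (rule gen_action_eq_sum[of v])
  define n where "n = r + N + i"
  have "s (1 / fact i) (L (int i - 1) v - c i) = 0"
  proof (rule power_sum_eq_0_imp_coeffs_0[OF vector_space_axioms,
        where n = n and c = "\<lambda>i. s (1 / fact i) (L (int i - 1) v - c i)"])
    fix m :: int
    have "gen_action s \<rho> m v = (\<Sum>i\<le>n. s (of_int m ^ i / fact i) (c i))"
      unfolding eq by (rule sum.mono_neutral_left) (auto simp: n_def c)
    moreover have "gen_action s \<rho> m v = (\<Sum>i\<le>n. s (of_int m ^ i / fact i) (L (int i - 1) v))"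
      using r[rule_format, of "Suc n" m] unfolding lessThan_Suc_atMost by (simp add: n_def)
    ultimately show "(\<Sum>k\<le>n. s (of_int m ^ k) (s (1 / fact k) (L (int k - 1) v - c k))) = 0"
      by (simp add: scale_right_diff_distrib sum_subtractf)
  qed (simp add: n_def)
  then show ?thesis by simp
qed

text \<open>If the series vanished everywhere, coefficient comparison would make each
  \<open>L i\<close>, hence all of \<open>vir_a\<close>, act as zero.\<close>

lemma nontrivial: "\<exists>v m. gen_action s \<rho> m v \<noteq> 0"
proof (rule ccontr)
  assume "\<not> ?thesis"
  then have "gen_action s \<rho> m v = 0" for v m by blast
  then have *: "L (int i - 1) v = 0" for i v
    by (intro gen_action_unique[where N = 0]) simp_all
  have "\<rho> x v = 0" if "x \<in> vir_a" for x v
    using that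
  proof (induction rule: vir_a_induct)
    case (L i)
    then show ?case using *[of "nat (i + 1)"] by simp
  qed (simp_all add: action_zero action_add action_scale)
  then show False using category by (simp add: category_C_def trivial_module_def)
qed

lemma highest_weight_module_if_simple:
  assumes "simple_module vir_a s \<rho>" "v \<noteq> 0" "L 0 v = s \<beta> v" "\<And>i. i \<ge> 1 \<Longrightarrow> L i v = 0"
  shows "highest_weight_module s \<rho> \<beta>"
proof -
  have "W = UNIV" if "lie_submodule vir_a s \<rho> W" "{v} \<subseteq> W" for W
    using assms(1,2) that by (auto simp: simple_module_def)
  then have "lie_submodule vir_a s \<rho> hull {v} = UNIV"
    by (auto simp: hull_def)
  with assms(2-4) show ?thesis
    unfolding highest_weight_module_def by (intro conjI exI[of _ v] lie_module) simp_all
qed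

end

subsection \<open>The two exponential parts of the action of \<open>L\<^sub>m\<close>\<close>

text \<open>The coefficient of \<open>l powi m\<close> in the action of \<open>L_m\<close>.
  \<open>T\<close> stands for \<open>L (-1)\<close>; keeping it abstract lets the formula also cover
  the polynomial model of a highest weight module.\<close>

definition part1 :: "(complex \<Rightarrow> 'v::ab_group_add \<Rightarrow> 'v) \<Rightarrow> ('v \<Rightarrow> 'v) \<Rightarrow> complex \<Rightarrow> int \<Rightarrow> 'v poly \<Rightarrow> 'v poly"
  where "part1 s T \<alpha> m p = (\<Sum>k\<le>degree p.
    tensor s (coeff p k) ([:- of_int m * \<alpha>, 1:] * [:- of_int m, 1:] ^ k)
    - tensor s (T (coeff p k)) ([:- of_int m, 1:] ^ k))"

definition part2 :: "(complex \<Rightarrow> 'v::ab_group_add \<Rightarrow> 'v) \<Rightarrow> (int \<Rightarrow> 'v \<Rightarrow> 'v) \<Rightarrow> int \<Rightarrow> 'v poly \<Rightarrow> 'v poly"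
  where "part2 s D m p = (\<Sum>k\<le>degree p. tensor s (D m (coeff p k)) ([:- of_int m, 1:] ^ k))"

lemma pcompose_monom_1: "pcompose (monom (1 :: complex) k) q = q ^ k"
  by (induction k) (simp_all add: pcompose_1 monom_Suc pcompose_pCons flip: one_pCons)

lemma M_L_parts:
  assumes "vector_space s"
  shows "M_L s \<rho> \<mu> l \<alpha> m p =
    tensor_scale s (l powi m) (part1 s (\<rho> (vir_L (-1))) \<alpha> m p)
    + tensor_scale s ((l * \<mu>) powi m) (part2 s (gen_action s \<rho>) m p)"
proof -
  interpret vector_space s by (rule assms)
  show ?thesis
    by (rule poly_eqI)
      (simp add: M_L_def M_tensor_def part1_def part2_def pcompose_monom_1 gen_action_def[symmetric]
        coeff_sum coeff_tensor[OF assms] coeff_tensor_scale[OF assms] sum.distrib sum_subtractf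
        scale_sum_right scale_right_distrib scale_right_diff_distrib power_int_mult_distrib
        mult_ac)
qed

lemma linear_tensor:
  assumes "vector_space s"
  shows "Vector_Spaces.linear s (tensor_scale s) (\<lambda>v. tensor s v f)"
    and "Vector_Spaces.linear smult (tensor_scale s) (tensor s v)"
  using assms vector_space_tensor_scale[OF assms]
  by (simp_all add: Vector_Spaces.linear_iff tensor_bilinear vector_space_def poly_eq_iff
      algebra_simps)

lemma vector_space_smult: "vector_space (smult :: complex \<Rightarrow> complex poly \<Rightarrow> complex poly)"
  by (simp add: vector_space_def poly_eq_iff algebra_simps)

lemma polyfun_poly_mult:
  assumes "polyfun smult f" "polyfun smult g"
  shows "polyfun (smult :: complex \<Rightarrow> complex poly \<Rightarrow> _) (\<lambda>m. f m * g m)"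
proof (rule polyfun_bilinear[OF _ _ assms])
  show "Vector_Spaces.linear smult smult (\<lambda>u. u * v)" for v :: "complex poly"
    by (simp add: Vector_Spaces.linear_iff vector_space_smult distrib_right)
  show "Vector_Spaces.linear smult smult ((*) u)" for u :: "complex poly"
    by (simp add: Vector_Spaces.linear_iff vector_space_smult distrib_left)
qed

lemma polyfun_linear_poly: "polyfun smult (\<lambda>m. [:- of_int m * c, 1 :: complex:])"
  using polyfun.add[OF polyfun.const[of smult "[:0, 1:]"] polyfun.mult[OF polyfun.const[of smult "[:- c:]"]]]
  by simp

lemma polyfun_linear_power: "polyfun smult (\<lambda>m. [:- of_int m, 1 :: complex:] ^ k)"
proof (induction k)
  case 0
  then show ?case by (simp add: polyfun.const)
next
  case (Suc k)
  show ?case using polyfun_poly_mult[OF polyfun_linear_poly[of 1] Suc] by simp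
qed

lemma polyfun_parts:
  assumes vs: "vector_space s"
  shows "polyfun (tensor_scale s) (\<lambda>m. part1 s T \<alpha> m p)"
    and "(\<And>v. polyfun s (\<lambda>m. D m v)) \<Longrightarrow> polyfun (tensor_scale s) (\<lambda>m. part2 s D m p)"
proof -
  note pw = polyfun_linear_power
  have "polyfun smult (\<lambda>m. [:- of_int m * \<alpha>, 1:] * [:- of_int m, 1:] ^ k)" for k
    by (rule polyfun_poly_mult[OF polyfun_linear_poly pw])
  from this pw show "polyfun (tensor_scale s) (\<lambda>m. part1 s T \<alpha> m p)"
    unfolding part1_def
    by (intro polyfun_sum polyfun_diff[OF vector_space_tensor_scale[OF vs]])
      (rule polyfun_linear[OF linear_tensor(2)[OF vs]]; assumption)+
  show "polyfun (tensor_scale s) (\<lambda>m. part2 s D m p)" if "\<And>v. polyfun s (\<lambda>m. D m v)"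
    unfolding part2_def
    by (rule polyfun_sum, rule polyfun_bilinear[OF linear_tensor[OF vs] that pw])
qed

text \<open>On \<open>v \<otimes> 1\<close> only the factor \<open>\<partial> - m \<alpha>\<close>
  involves \<open>m\<close>. This affine form in \<open>m\<close> is what an intertwiner carries
  over to the other module.\<close>

lemma part1_const:
  assumes "vector_space s"
  shows "part1 s T \<alpha> m [:v:] = part1 s T \<alpha> 0 [:v:] - tensor_scale s (of_int m * \<alpha>) [:v:]"
proof -
  interpret vector_space s by (rule assms)
  show ?thesis
    by (rule poly_eqI)
      (auto simp: part1_def coeff_tensor[OF assms] coeff_tensor_scale[OF assms] coeff_pCons
        split: nat.splits)
qed

lemma part2_const:
  assumes "vector_space s"
  shows "part2 s D m [:v:] = [:D m v:]"
proof -
  interpret vector_space s by (rule assms)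
  show ?thesis
    by (rule poly_eqI)
      (auto simp: part2_def coeff_tensor[OF assms] coeff_pCons split: nat.splits)
qed

text \<open>Setting \<open>\<partial> = 0\<close> turns each power of \<open>\<partial> - m\<close>
  into a power of \<open>- m\<close>, which makes the dependence on \<open>m\<close>
  explicit.\<close>

lemma coeff_0_part1:
  assumes "vector_space s"
  shows "coeff (part1 s T \<alpha> m p) 0 = (\<Sum>k\<le>degree p.
    s ((- of_int m) ^ k) (s (- of_int m * \<alpha>) (coeff p k) - T (coeff p k)))"
proof -
  interpret vector_space s by (rule assms)
  have "coeff ([:- complex_of_int m, 1:] ^ k) 0 = (- of_int m) ^ k" for k
    by (simp add: poly_0_coeff_0[symmetric] poly_power)
  then show ?thesis
    by (simp add: part1_def coeff_sum coeff_tensor[OF assms] coeff_mult_0 scale_right_diff_distrib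
        mult_ac)
qed

text \<open>The powers of \<open>\<partial> - m\<close> are monic, so only the top summand reaches
  \<open>degree p\<close>.\<close>

lemma coeff_degree_part2:
  assumes "vector_space s"
  shows "coeff (part2 s D m p) (degree p) = D m (coeff p (degree p))"
proof -
  interpret vector_space s by (rule assms)
  have "coeff (part2 s D m p) (degree p)
      = (\<Sum>k\<le>degree p. if k = degree p then D m (coeff p k) else 0)"
    unfolding part2_def coeff_sum
    by (rule sum.cong)
      (auto simp: coeff_tensor[OF assms] coeff_linear_power degree_linear_power coeff_eq_0)
  then show ?thesis by simp
qed

subsection \<open>Homomorphisms\<close>

lemma M_act_L:
  assumes "vector_space s"
  shows "M_act s \<rho> \<mu> l \<alpha> (vir_L m) p = M_L s \<rho> \<mu> l \<alpha> m p"
proof -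
  interpret vector_space s by (rule assms)
  show ?thesis
    by (simp add: M_act_def vir_L_def poly_eq_iff coeff_tensor_scale[OF assms])
qed

lemma part1_0_const:
  assumes "vector_space s"
  shows "part1 s T \<alpha> 0 [:v:] = [:- T v, v:]"
proof -
  interpret vector_space s by (rule assms)
  show ?thesis
    by (rule poly_eqI)
      (auto simp: part1_def coeff_tensor[OF assms] coeff_pCons split: nat.splits)
qed

text \<open>The idea is to compare the highest powers of \<open>m\<close> in the constant coefficients.\<close>

lemma part1_affine_imp_const:
  assumes vs: "vector_space s" and T0: "T 0 = 0" and u: "u \<noteq> 0" and \<alpha>: "\<alpha> \<noteq> 0"
    and affine: "\<And>m. part1 s T \<alpha> m u = part1 s T \<alpha> 0 u - tensor_scale s (of_int m * \<beta>) u"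
  shows "degree u = 0 \<and> \<alpha> = \<beta>"
proof -
  interpret vector_space s by (rule vs)
  define d where "d = degree u"
  \<comment> \<open>The coefficient of \<open>n ^ k\<close> in the difference of both sides of
    \<open>affine\<close> at \<open>m = - n\<close>, taken in degree 0 in \<open>\<partial>\<close>.
    The choice \<open>m = - n\<close> removes the signs.\<close>
  define c where "c k = (if k = 0 then 0 else s \<alpha> (coeff u (k - 1))) - T (coeff u k)
      + (if k = 0 then T (coeff u 0) else 0) - (if k = 1 then s \<beta> (coeff u 0) else 0)" for k
  have "c (Suc d) = 0"
  proof (rule power_sum_eq_0_imp_coeffs_0[OF vs, where n = "Suc d" and c = c])
    fix n :: int
    have at0: "coeff (part1 s T \<alpha> 0 u) 0 = - T (coeff u 0)"
    proof -
      have "coeff (part1 s T \<alpha> 0 u) 0 = (\<Sum>k\<le>d. if k = 0 then - T (coeff u 0) else 0)"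
        unfolding coeff_0_part1[OF vs] d_def by (rule sum.cong) auto
      then show ?thesis by simp
    qed
    have 1: "(\<Sum>k\<le>Suc d. s (of_int n ^ k) (if k = 0 then 0 else s \<alpha> (coeff u (k - 1))))
        = (\<Sum>k\<le>d. s (of_int n ^ k) (s (of_int n * \<alpha>) (coeff u k)))"
      by (subst sum.atMost_Suc_shift) (simp add: mult_ac)
    have 2: "(\<Sum>k\<le>Suc d. s (of_int n ^ k) (T (coeff u k)))
        = (\<Sum>k\<le>d. s (of_int n ^ k) (T (coeff u k)))"
      by (simp add: d_def coeff_eq_0 T0)
    have 3: "(\<Sum>k\<le>Suc d. s (of_int n ^ k) (if k = 0 then T (coeff u 0) else 0)) = T (coeff u 0)"
      by (subst sum.atMost_Suc_shift) simp
    have 4: "(\<Sum>k\<le>Suc d. s (of_int n ^ k) (if k = 1 then s \<beta> (coeff u 0) else 0))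
        = s (of_int n * \<beta>) (coeff u 0)"
    proof -
      have "(\<Sum>k\<le>Suc d. s (of_int n ^ k) (if k = 1 then s \<beta> (coeff u 0) else 0))
        = (\<Sum>k\<le>Suc d. if k = 1 then s (of_int n * \<beta>) (coeff u 0) else 0)"
        by (rule sum.cong) auto
      then show ?thesis by (simp add: sum.delta)
    qed
    have "(\<Sum>k\<le>Suc d. s (of_int n ^ k) (c k))
        = coeff (part1 s T \<alpha> (- n) u) 0 + T (coeff u 0) - s (of_int n * \<beta>) (coeff u 0)"
      unfolding c_def scale_right_distrib scale_right_diff_distrib sum.distrib sum_subtractf 1 2 3 4
      by (simp add: coeff_0_part1[OF vs] d_def scale_right_diff_distrib sum_subtractf)
    also have "coeff (part1 s T \<alpha> (- n) u) 0 = - T (coeff u 0) + s (of_int n * \<beta>) (coeff u 0)"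
      unfolding affine[of "- n"] coeff_diff at0 coeff_tensor_scale[OF vs] by simp
    finally show "(\<Sum>k\<le>Suc d. s (of_int n ^ k) (c k)) = 0" by simp
  qed simp
  \<comment> \<open>For \<open>d > 0\<close> this is a nonzero multiple of the leading coefficient,
    so \<open>d = 0\<close>; then \<open>\<alpha> - \<beta>\<close> annihilates that
    coefficient.\<close>
  moreover have "c (Suc d) = s \<alpha> (coeff u d) - (if d = 0 then s \<beta> (coeff u d) else 0)"
    by (simp add: c_def d_def coeff_eq_0 T0)
  moreover have "coeff u d \<noteq> 0" using u by (simp add: d_def)
  ultimately have "d = 0 \<and> s (\<alpha> - \<beta>) (coeff u d) = 0"
    using \<alpha> by (auto simp: scale_left_diff_distrib split: if_splits)
  then show ?thesis using \<open>coeff u d \<noteq> 0\<close> by (auto simp: d_def)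
qed

context C_module
begin

lemma gen_action_zero: "gen_action s \<rho> m 0 = 0"
  using gen_action_sum[where N = 0 and v = 0] L_zero by simp

text \<open>In top degree the condition concerns the leading coefficient \<open>w\<close> alone. Its
  series is affine in \<open>m\<close>: the linear term gives \<open>L 0 w\<close>, and the missing
  higher powers give \<open>L i w = 0\<close> for \<open>i \<ge> 1\<close>.\<close>

lemma part2_affine_imp_highest_weight_vector:
  assumes u: "u \<noteq> 0" and affine: "\<And>m. part2 s (gen_action s \<rho>) m u
      = part2 s (gen_action s \<rho>) 0 u - tensor_scale s (of_int m * \<beta>) u"
  shows "\<exists>w. w \<noteq> 0 \<and> L 0 w = s (- \<beta>) w \<and> (\<forall>i\<ge>1. L i w = 0)"
proof -
  define w where "w = lead_coeff u"
  define c where "c i = (if i = 0 then L (-1) w else if i = 1 then s (- \<beta>) w else 0)" for i :: nat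
  have "gen_action s \<rho> m w = (\<Sum>i<2. s (of_int m ^ i / fact i) (c i))" for m
  proof -
    have "gen_action s \<rho> m w = gen_action s \<rho> 0 w - s (of_int m * \<beta>) w"
      using arg_cong[OF affine[of m], of "\<lambda>p. coeff p (degree u)"]
      by (simp add: coeff_degree_part2[OF vector_space_axioms]
          coeff_tensor_scale[OF vector_space_axioms] w_def)
    then show ?thesis by (simp add: gen_action_0 c_def numeral_2_eq_2)
  qed
  then have c: "L (int i - 1) w = c i" for i
    by (rule gen_action_unique) (simp add: c_def)
  have "L 0 w = s (- \<beta>) w" using c[of 1] by (simp add: c_def)
  moreover have "L i w = 0" if "i \<ge> 1" for i
    using c[of "nat (i + 1)"] that by (simp add: c_def nat_eq_iff)
  moreover have "w \<noteq> 0" using u by (simp add: w_def)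
  ultimately show ?thesis by blast
qed

end

section \<open>Injective intertwiners between two of the modules\<close>

locale M_hom = V1: C_module s1 \<rho>1 + V2: C_module s2 \<rho>2
  for s1 :: "complex \<Rightarrow> 'v::ab_group_add \<Rightarrow> 'v" and \<rho>1
    and s2 :: "complex \<Rightarrow> 'w::ab_group_add \<Rightarrow> 'w" and \<rho>2 +
  fixes \<mu>1 l1 \<alpha>1 \<mu>2 l2 \<alpha>2 :: complex and \<phi> :: "'v poly \<Rightarrow> 'w poly"
  assumes nonzero: "l1 \<noteq> 0" "\<mu>1 \<noteq> 0" "\<mu>1 \<noteq> 1" "l2 \<noteq> 0" "\<alpha>2 \<noteq> 0" "\<mu>2 \<noteq> 0" "\<mu>2 \<noteq> 1"
    and linear: "Vector_Spaces.linear (tensor_scale s1) (tensor_scale s2) \<phi>"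
    and inj: "inj \<phi>"
    and intertwines: "\<phi> (M_L s1 \<rho>1 \<mu>1 l1 \<alpha>1 m p) = M_L s2 \<rho>2 \<mu>2 l2 \<alpha>2 m (\<phi> p)"
begin

sublocale \<phi>: Vector_Spaces.linear "tensor_scale s1" "tensor_scale s2" \<phi>
  by (rule linear)

abbreviation "A1 \<equiv> part1 s1 (\<rho>1 (vir_L (-1))) \<alpha>1"
abbreviation "A2 \<equiv> part1 s2 (\<rho>2 (vir_L (-1))) \<alpha>2"
abbreviation "B2 \<equiv> part2 s2 (gen_action s2 \<rho>2)"

lemma \<phi>_eq_0_iff: "\<phi> p = 0 \<longleftrightarrow> p = 0"
  using inj \<phi>.zero by (metis injD)

lemma intertwines_parts:
  "tensor_scale s2 (l1 powi m) (\<phi> (A1 m [:v:]))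
      + tensor_scale s2 ((l1 * \<mu>1) powi m) (\<phi> [:gen_action s1 \<rho>1 m v:])
    = tensor_scale s2 (l2 powi m) (A2 m (\<phi> [:v:]))
      + tensor_scale s2 ((l2 * \<mu>2) powi m) (B2 m (\<phi> [:v:]))"
  using intertwines[of m "[:v:]"]
  unfolding M_L_parts[OF V1.vector_space_axioms] M_L_parts[OF V2.vector_space_axioms]
    part2_const[OF V1.vector_space_axioms] \<phi>.add \<phi>.scale .

lemma polyfun_gen_action_image:
  "polyfun (tensor_scale s2) (\<lambda>m. \<phi> [:gen_action s1 \<rho>1 m v:])"
proof -
  have "polyfun (tensor_scale s1) (\<lambda>m. part2 s1 (gen_action s1 \<rho>1) m [:v:])"
    by (rule polyfun_parts(2)[OF V1.vector_space_axioms V1.polyfun_gen_action])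
  then show ?thesis
    unfolding part2_const[OF V1.vector_space_axioms] by (rule polyfun_linear[OF linear])
qed

text \<open>This is \<open>two_exponentials\<close> with the bases \<open>l1\<close>,
  \<open>l1 * \<mu>1\<close> against \<open>l2\<close>, \<open>l2 * \<mu>2\<close>; the bases in
  each pair differ because \<open>\<mu>1\<close> and \<open>\<mu>2\<close> are not 1.\<close>

lemma compare_exponentials:
  shows "l1 = l2 \<Longrightarrow> l1 * \<mu>1 = l2 * \<mu>2 \<Longrightarrow>
      \<phi> (A1 m [:v:]) = A2 m (\<phi> [:v:]) \<and> \<phi> [:gen_action s1 \<rho>1 m v:] = B2 m (\<phi> [:v:])"
    and "l1 = l2 * \<mu>2 \<Longrightarrow> l1 * \<mu>1 = l2 \<Longrightarrow>
      \<phi> (A1 m [:v:]) = B2 m (\<phi> [:v:]) \<and> \<phi> [:gen_action s1 \<rho>1 m v:] = A2 m (\<phi> [:v:])"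
    and "l1 \<noteq> l2 \<Longrightarrow> l1 \<noteq> l2 * \<mu>2 \<Longrightarrow> \<phi> (A1 m [:v:]) = 0"
    and "l1 * \<mu>1 \<noteq> l2 \<Longrightarrow> l1 * \<mu>1 \<noteq> l2 * \<mu>2 \<Longrightarrow> \<phi> [:gen_action s1 \<rho>1 m v:] = 0"
proof -
  have nz: "l1 \<noteq> 0" "l1 * \<mu>1 \<noteq> 0" "l2 \<noteq> 0" "l2 * \<mu>2 \<noteq> 0" "l1 \<noteq> l1 * \<mu>1" "l2 \<noteq> l2 * \<mu>2"
    using nonzero by auto
  note * = two_exponentials[OF vector_space_tensor_scale[OF V2.vector_space_axioms] nz
      polyfun_linear[OF linear polyfun_parts(1)[OF V1.vector_space_axioms]]
      polyfun_gen_action_image polyfun_parts(1)[OF V2.vector_space_axioms]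
      polyfun_parts(2)[OF V2.vector_space_axioms V2.polyfun_gen_action] intertwines_parts]
  show "l1 = l2 \<Longrightarrow> l1 * \<mu>1 = l2 * \<mu>2 \<Longrightarrow>
      \<phi> (A1 m [:v:]) = A2 m (\<phi> [:v:]) \<and> \<phi> [:gen_action s1 \<rho>1 m v:] = B2 m (\<phi> [:v:])"
    by (rule *(1))
  show "l1 = l2 * \<mu>2 \<Longrightarrow> l1 * \<mu>1 = l2 \<Longrightarrow>
      \<phi> (A1 m [:v:]) = B2 m (\<phi> [:v:]) \<and> \<phi> [:gen_action s1 \<rho>1 m v:] = A2 m (\<phi> [:v:])"
    by (rule *(2))
  show "l1 \<noteq> l2 \<Longrightarrow> l1 \<noteq> l2 * \<mu>2 \<Longrightarrow> \<phi> (A1 m [:v:]) = 0"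
    by (rule *(3))
  show "l1 * \<mu>1 \<noteq> l2 \<Longrightarrow> l1 * \<mu>1 \<noteq> l2 * \<mu>2 \<Longrightarrow> \<phi> [:gen_action s1 \<rho>1 m v:] = 0"
    by (rule *(4))
qed

lemma A1_const: "\<phi> (A1 m [:v:]) = \<phi> (A1 0 [:v:]) - tensor_scale s2 (of_int m * \<alpha>1) (\<phi> [:v:])"
  by (subst part1_const[OF V1.vector_space_axioms]) (simp add: \<phi>.diff \<phi>.scale)

text \<open>For a suitable \<open>v\<close> both parts of the first module are nonzero on
  \<open>v \<otimes> 1\<close> for some \<open>m\<close>, so both of its bases occur in the second
  module. Two distinct bases can only be matched or swapped.\<close>

lemma exponentials_match:
  "l1 = l2 \<and> \<mu>1 = \<mu>2 \<or> l1 = l2 * \<mu>2 \<and> l2 = l1 * \<mu>1"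
proof -
  obtain v m where v: "gen_action s1 \<rho>1 m v \<noteq> 0" using V1.nontrivial by blast
  then have "v \<noteq> 0" using V1.gen_action_zero by auto
  then have "\<phi> (A1 0 [:v:]) \<noteq> 0"
    by (simp add: \<phi>_eq_0_iff part1_0_const[OF V1.vector_space_axioms])
  then have 1: "l1 = l2 \<or> l1 = l2 * \<mu>2"
    using compare_exponentials(3)[of 0 v] nonzero by auto
  have "\<phi> [:gen_action s1 \<rho>1 m v:] \<noteq> 0" using v by (simp add: \<phi>_eq_0_iff)
  then have 2: "l1 * \<mu>1 = l2 \<or> l1 * \<mu>1 = l2 * \<mu>2"
    using compare_exponentials(4)[of m v] nonzero by auto
  from 1 2 nonzero show ?thesis by auto
qed

text \<open>Under the swap, \<open>B2\<close> on the image of \<open>v \<otimes> 1\<close> inherits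
  the affine form of \<open>A1\<close>.\<close>

lemma swapped_highest_weight_vector:
  assumes "l1 = l2 * \<mu>2" "l2 = l1 * \<mu>1"
  shows "\<exists>w. w \<noteq> 0 \<and> V2.L 0 w = s2 (- \<alpha>1) w \<and> (\<forall>i\<ge>1. V2.L i w = 0)"
proof -
  obtain v m where v: "gen_action s1 \<rho>1 m v \<noteq> 0" using V1.nontrivial by blast
  then have "v \<noteq> 0" using V1.gen_action_zero by auto
  then have "\<phi> [:v:] \<noteq> 0" by (simp add: \<phi>_eq_0_iff)
  moreover have "\<phi> (A1 m [:v:]) = B2 m (\<phi> [:v:])" for m
    using compare_exponentials(2)[OF assms(1) assms(2)[symmetric]] by blast
  then have "B2 m (\<phi> [:v:]) = B2 0 (\<phi> [:v:]) - tensor_scale s2 (of_int m * \<alpha>1) (\<phi> [:v:])" for m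
    using A1_const[of m v] by metis
  ultimately show ?thesis by (rule V2.part2_affine_imp_highest_weight_vector)
qed

section \<open>The matched case: restriction to a map from \<open>V1\<close> to
  \<open>V2\<close>\<close>

context
  assumes same: "l1 = l2" "\<mu>1 = \<mu>2"
begin

lemma same_intertwines:
  "\<phi> (A1 m [:v:]) = A2 m (\<phi> [:v:])" "\<phi> [:gen_action s1 \<rho>1 m v:] = B2 m (\<phi> [:v:])"
  using compare_exponentials(1)[of m v] same by simp_all

text \<open>Here \<open>A2\<close> on the image of \<open>v \<otimes> 1\<close> inherits the affine
  form of \<open>A1\<close>, and \<open>\<alpha>2 \<noteq> 0\<close> makes
  \<open>part1_affine_imp_const\<close> applicable.\<close>

lemma same_const:
  assumes "v \<noteq> 0"
  shows "degree (\<phi> [:v:]) = 0 \<and> \<alpha>2 = \<alpha>1"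
proof (rule part1_affine_imp_const[OF V2.vector_space_axioms])
  show "A2 m (\<phi> [:v:]) = A2 0 (\<phi> [:v:]) - tensor_scale s2 (of_int m * \<alpha>1) (\<phi> [:v:])" for m
    using A1_const[of m v] same_intertwines(1) by metis
qed (use assms nonzero in \<open>simp_all add: \<phi>_eq_0_iff V2.L_zero\<close>)

lemma same_\<alpha>: "\<alpha>1 = \<alpha>2"
proof -
  obtain v m where v: "gen_action s1 \<rho>1 m v \<noteq> 0" using V1.nontrivial by blast
  then have "v \<noteq> 0" using V1.gen_action_zero by auto
  then show ?thesis using same_const by auto
qed

definition restriction :: "'v \<Rightarrow> 'w" where "restriction v = coeff (\<phi> [:v:]) 0"

lemma \<phi>_const: "\<phi> [:v:] = [:restriction v:]"
proof (cases "v = 0")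
  case True
  then show ?thesis by (simp add: restriction_def \<phi>.zero)
next
  case False
  then obtain w where "\<phi> [:v:] = [:w:]" using same_const[OF False] by (auto elim: degree_eq_zeroE)
  then show ?thesis by (simp add: restriction_def)
qed

lemma linear_restriction: "Vector_Spaces.linear s1 s2 restriction"
proof -
  have "\<phi> [:v + w:] = \<phi> [:v:] + \<phi> [:w:]" for v w
    using \<phi>.add[of "[:v:]" "[:w:]"] by simp
  moreover have "[:s1 c v:] = tensor_scale s1 c [:v:]" for c v
    by (rule poly_eqI)
      (simp add: coeff_tensor_scale[OF V1.vector_space_axioms] coeff_pCons split: nat.splits)
  then have "\<phi> [:s1 c v:] = tensor_scale s2 c (\<phi> [:v:])" for c v
    by (simp add: \<phi>.scale)
  ultimately show ?thesis
    by (simp add: Vector_Spaces.linear_iff restriction_def V1.vector_space_axioms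
        V2.vector_space_axioms coeff_tensor_scale[OF V2.vector_space_axioms])
qed

text \<open>The matched second parts say that \<open>restriction\<close> commutes with the whole
  series; coefficient comparison isolates each \<open>L i\<close>.\<close>

lemma restriction_L:
  assumes "i \<ge> -1"
  shows "restriction (V1.L i v) = V2.L i (restriction v)"
proof -
  interpret f: Vector_Spaces.linear s1 s2 restriction by (rule linear_restriction)
  obtain r :: nat where r: "\<forall>i\<ge>int r. V1.L i v = 0" using V1.L_eventually_zero by blast
  have zero: "V1.L (int i - 1) v = 0" if "Suc r \<le> i" for i
    using r that by simp
  have "gen_action s2 \<rho>2 m (restriction v)
      = (\<Sum>i<Suc r. s2 (of_int m ^ i / fact i) (restriction (V1.L (int i - 1) v)))" for m
  proof -
    have "[:restriction (gen_action s1 \<rho>1 m v):] = [:gen_action s2 \<rho>2 m (restriction v):]"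
      using same_intertwines(2)[of m v] unfolding \<phi>_const part2_const[OF V2.vector_space_axioms] .
    then show ?thesis
      using V1.gen_action_sum[OF zero, where m = m] by (simp add: f.sum f.scale f.add)
  qed
  then have "V2.L (int i - 1) (restriction v) = restriction (V1.L (int i - 1) v)" for i
    by (rule V2.gen_action_unique) (simp add: zero f.zero)
  from this[of "nat (i + 1)"] show ?thesis using assms by simp
qed

lemma restriction_action:
  assumes "x \<in> vir_a"
  shows "restriction (\<rho>1 x v) = \<rho>2 x (restriction v)"
proof -
  interpret f: Vector_Spaces.linear s1 s2 restriction by (rule linear_restriction)
  show ?thesis
    using assms
    by (induction rule: vir_a_induct)
      (simp_all add: restriction_L V1.action_zero V2.action_zero f.zero V1.action_add V2.action_add
        f.add V1.action_scale V2.action_scale f.scale)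
qed

end

end

subsection \<open>Simple highest weight modules as polynomials in \<open>L\<^sub>-\<^sub>1\<close>\<close>

text \<open>The action of \<open>L_m\<close> on the rank one module
  \<open>\<Omega>(1, -\<beta>)\<close>.\<close>

definition hw_action :: "complex \<Rightarrow> int \<Rightarrow> complex poly \<Rightarrow> complex poly" where
  "hw_action \<beta> m f = [:of_int m * \<beta>, 1:] * pcompose f [:- of_int m, 1:]"

lemma hw_action_0: "hw_action \<beta> m 0 = 0"
  by (simp add: hw_action_def)

text \<open>Multiplication by the variable obeys the same commutation rule with
  \<open>hw_action\<close> as \<open>L (-1)\<close> does with \<open>gen_action\<close> in
  \<open>gen_action_L\<close>.\<close>

lemma hw_action_pCons:
  "hw_action \<beta> m (pCons c f)
    = smult c [:of_int m * \<beta>, 1:] + (pCons 0 (hw_action \<beta> m f) - smult (of_int m) (hw_action \<beta> m f))"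
  by (simp add: hw_action_def pcompose_pCons algebra_simps smult_add_right)

context C_module
begin

lemma gen_action_add: "gen_action s \<rho> m (v + w) = gen_action s \<rho> m v + gen_action s \<rho> m w"
proof -
  obtain q r :: nat where q: "\<forall>i\<ge>int q. L i v = 0" and r: "\<forall>i\<ge>int r. L i w = 0"
    using L_eventually_zero by blast
  have 0: "L (int i - 1) v = 0" "L (int i - 1) w = 0" if "q + r + 1 \<le> i" for i
    using q r that by simp_all
  then have "L (int i - 1) (v + w) = 0" if "q + r + 1 \<le> i" for i
    using that by (simp add: L_add)
  from gen_action_sum[OF this, where m = m] gen_action_sum[OF 0(1), where m = m]
    gen_action_sum[OF 0(2), where m = m]
  show ?thesis
    by (simp add: L_add scale_right_distrib sum.distrib del: sum.lessThan_Suc)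
qed

lemma gen_action_scale: "gen_action s \<rho> m (s c v) = s c (gen_action s \<rho> m v)"
proof -
  obtain r :: nat where r: "\<forall>i\<ge>int r. L i v = 0"
    using L_eventually_zero by blast
  have 0: "L (int i - 1) v = 0" if "r + 1 \<le> i" for i
    using r that by simp
  then have "L (int i - 1) (s c v) = 0" if "r + 1 \<le> i" for i
    using that by (simp add: L_scale)
  from gen_action_sum[OF this, where m = m] gen_action_sum[OF 0, where m = m]
  show ?thesis
    by (simp add: L_scale scale_sum_right mult_ac del: sum.lessThan_Suc)
qed

text \<open>By \<open>[L_(-1), L_(i-1)] = i L_(i-2)\<close>, commuting with \<open>L (-1)\<close>
  shifts the series by one index; against the factorials this amounts to a factor
  \<open>m\<close>.\<close>

lemma gen_action_L:
  "gen_action s \<rho> m (L (-1) v) = L (-1) (gen_action s \<rho> m v) - s (of_int m) (gen_action s \<rho> m v)"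
proof -
  interpret D: Vector_Spaces.linear s s "L (-1)"
    by (rule linear_action[OF vir_L_in_vir_a]) simp
  obtain q r :: nat where q: "\<forall>i\<ge>int q. L i v = 0" and r: "\<forall>i\<ge>int r. L i (L (-1) v) = 0"
    using L_eventually_zero by blast
  define N where "N = q + r + 1"
  have 0: "L (int i - 1) v = 0" "L (int i - 1) (L (-1) v) = 0" if "N \<le> i" for i
    using q r that by (simp_all add: N_def)
  \<comment> \<open>For \<open>i = 0\<close> the factor \<open>of_nat i\<close> cancels the term
    with \<open>L (-2)\<close>, which lies outside \<open>vir_a\<close>.\<close>
  have comm: "L (int i - 1) (L (-1) v) = L (-1) (L (int i - 1) v) - s (of_nat i) (L (int i - 2) v)" for i
  proof (cases i)
    case (Suc j)
    then show ?thesis using L_commute[of "int i - 1" "-1" v] by (simp flip: scale_minus_left)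
  qed simp
  have "gen_action s \<rho> m (L (-1) v)
      = (\<Sum>i<Suc N. s (of_int m ^ i / fact i) (L (int i - 1) (L (-1) v)))"
    by (rule gen_action_sum) (simp add: 0)
  also have "\<dots> = L (-1) (\<Sum>i<Suc N. s (of_int m ^ i / fact i) (L (int i - 1) v))
      - (\<Sum>i<Suc N. s (of_int m ^ i / fact i) (s (of_nat i) (L (int i - 2) v)))"
    by (simp only: comm D.sum D.scale scale_right_diff_distrib sum_subtractf)
  also have "(\<Sum>i<Suc N. s (of_int m ^ i / fact i) (L (int i - 1) v)) = gen_action s \<rho> m v"
    by (rule gen_action_sum[symmetric]) (simp add: 0)
  \<comment> \<open>The term at 0 vanishes. Starting from \<open>Suc N\<close> leaves
    \<open>N\<close> terms after the shift, still a full truncation.\<close>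
  also have "(\<Sum>i<Suc N. s (of_int m ^ i / fact i) (s (of_nat i) (L (int i - 2) v)))
      = (\<Sum>i<N. s (of_int m ^ Suc i / fact (Suc i)) (s (of_nat (Suc i)) (L (int i - 1) v)))"
    by (subst sum.lessThan_Suc_shift) simp
  also have "\<dots> = s (of_int m) (\<Sum>i<N. s (of_int m ^ i / fact i) (L (int i - 1) v))"
  proof -
    have "of_int m ^ Suc i / fact (Suc i) * of_nat (Suc i) = of_int m * (of_int m ^ i / fact i :: complex)" for i
      by (simp add: field_simps del: of_nat_Suc)
    then show ?thesis by (simp only: scale_sum_right scale_scale)
  qed
  also have "(\<Sum>i<N. s (of_int m ^ i / fact i) (L (int i - 1) v)) = gen_action s \<rho> m v"
    by (rule gen_action_sum[symmetric]) (simp add: 0)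
  finally show ?thesis .
qed

text \<open>The vector \<open>f(L_(-1)) e\<close>, computed by Horner's scheme.\<close>

definition eval_at :: "'v \<Rightarrow> complex poly \<Rightarrow> 'v" where
  "eval_at e f = fold_coeffs (\<lambda>c v. s c e + L (-1) v) f 0"

lemma eval_at_0: "eval_at e 0 = 0"
  by (simp add: eval_at_def)

lemma eval_at_pCons: "eval_at e (pCons c f) = s c e + L (-1) (eval_at e f)"
  by (cases "c = 0 \<and> f = 0") (auto simp: eval_at_def L_zero)

lemma eval_at_add: "eval_at e (f + g) = eval_at e f + eval_at e g"
  by (induction f g rule: poly_induct2) (simp_all add: eval_at_0 eval_at_pCons L_add scale_left_distrib)

lemma eval_at_smult: "eval_at e (smult c f) = s c (eval_at e f)"
  by (induction f) (simp_all add: eval_at_0 eval_at_pCons L_scale scale_right_distrib)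

lemma linear_eval_at: "Vector_Spaces.linear smult s (eval_at e)"
  by (simp add: Vector_Spaces.linear_iff vector_space_smult vector_space_axioms eval_at_add eval_at_smult)

lemma eval_at_mult_eq_0: "eval_at e f = 0 \<Longrightarrow> eval_at e (g * f) = 0"
  by (induction g) (simp_all add: eval_at_0 eval_at_pCons eval_at_add eval_at_smult L_zero)

context
  fixes e \<beta>
  assumes e: "e \<noteq> 0" and L0: "L 0 e = s \<beta> e" and L_pos: "\<And>i. i \<ge> 1 \<Longrightarrow> L i e = 0"
begin

lemma gen_action_hw_vector: "gen_action s \<rho> m e = L (-1) e + s (of_int m * \<beta>) e"
proof -
  have "L (int i - 1) e = 0" if "2 \<le> i" for i using L_pos that by simp
  from gen_action_sum[OF this, where m = m] show ?thesis
    by (simp add: numeral_2_eq_2 L0)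
qed

text \<open>Induction on \<open>f\<close>: at the highest weight vector only two terms of the series
  survive, and \<open>gen_action_L\<close> moves the series past each further
  \<open>L (-1)\<close>.\<close>

lemma gen_action_eval_at: "gen_action s \<rho> m (eval_at e f) = eval_at e (hw_action \<beta> m f)"
proof (induction f)
  case 0
  then show ?case by (simp add: eval_at_0 gen_action_zero hw_action_0)
next
  case (pCons c f)
  interpret E: Vector_Spaces.linear smult s "eval_at e" by (rule linear_eval_at)
  have "eval_at e [:of_int m * \<beta>, 1:] = gen_action s \<rho> m e"
    by (simp add: eval_at_0 eval_at_pCons L_zero gen_action_hw_vector)
  then show ?case
    by (simp add: hw_action_pCons eval_at_add E.diff eval_at_smult eval_at_pCons[of e 0]
        eval_at_pCons[of e c f] gen_action_add gen_action_scale gen_action_L pCons.IH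
        del: pCons.hyps smult_pCons)
qed

text \<open>Moving \<open>L i\<close> past \<open>L (-1)\<close> leaves a term with
  \<open>L (i - 1)\<close>, hence the induction over \<open>f\<close> with \<open>i\<close>
  arbitrary.\<close>

lemma L_eval_at_in_range: "i \<ge> -1 \<Longrightarrow> L i (eval_at e f) \<in> range (eval_at e)"
proof (induction f arbitrary: i)
  case 0
  then show ?case using eval_at_0 L_zero by (metis rangeI)
next
  case (pCons c f)
  interpret E: Vector_Spaces.linear smult s "eval_at e" by (rule linear_eval_at)
  show ?case
  proof (cases "i = -1")
    case True
    have "L (-1) (eval_at e (pCons c f)) = eval_at e (pCons 0 (pCons c f))"
      by (simp add: eval_at_pCons[of e 0])
    then show ?thesis using True by simp
  next
    case False
    with pCons.prems have i: "i \<ge> 0" by simp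
    obtain g where g: "L i (eval_at e f) = eval_at e g" using pCons.IH[of i] i by auto
    obtain h where h: "L (i - 1) (eval_at e f) = eval_at e h" using pCons.IH[of "i - 1"] i by auto
    obtain k where k: "L i e = eval_at e k"
    proof (cases "i = 0")
      case True
      then have "L i e = eval_at e [:\<beta>:]" by (simp add: L0 eval_at_pCons eval_at_0 L_zero)
      then show ?thesis by (rule that)
    next
      case False
      then have "L i e = eval_at e 0" using i L_pos[of i] by (simp add: eval_at_0)
      then show ?thesis by (rule that)
    qed
    have "L i (eval_at e (pCons c f))
        = s c (L i e) + (L (-1) (L i (eval_at e f)) + s (of_int (- 1 - i)) (L (i - 1) (eval_at e f)))"
      using i L_commute[of i "-1" "eval_at e f"] by (simp add: eval_at_pCons L_add L_scale)
    also have "\<dots> = eval_at e (smult c k + (pCons 0 g + smult (of_int (- 1 - i)) h))"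
      unfolding g h k eval_at_add eval_at_smult eval_at_pCons by simp
    finally show ?thesis by simp
  qed
qed

text \<open>The range is a submodule containing \<open>e\<close>, the value at 1, so simplicity
  applies.\<close>

lemma surj_eval_at:
  assumes "simple_module vir_a s \<rho>"
  shows "surj (eval_at e)"
proof -
  interpret E: Vector_Spaces.linear smult s "eval_at e" by (rule linear_eval_at)
  have sub: "subspace (range (eval_at e))"
  proof (rule subspaceI)
    show "0 \<in> range (eval_at e)" by (metis eval_at_0 rangeI)
    show "v + w \<in> range (eval_at e)" if "v \<in> range (eval_at e)" "w \<in> range (eval_at e)" for v w
      using that by (auto simp: eval_at_add[symmetric])
    show "s c v \<in> range (eval_at e)" if "v \<in> range (eval_at e)" for c v
      using that by (auto simp: eval_at_smult[symmetric])
  qed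
  have "\<rho> x v \<in> range (eval_at e)" if "x \<in> vir_a" "v \<in> range (eval_at e)" for x v
    using that
  proof (induction rule: vir_a_induct)
    case (L i)
    then show ?case using L_eval_at_in_range by blast
  qed (simp_all add: action_zero action_add action_scale subspace_0[OF sub] subspace_add[OF sub]
        subspace_scale[OF sub])
  with sub have "lie_submodule vir_a s \<rho> (range (eval_at e))"
    by (simp add: lie_submodule_def)
  then have "range (eval_at e) = {0} \<or> range (eval_at e) = UNIV"
    using assms by (simp add: simple_module_def)
  moreover have "eval_at e 1 = e"
    by (simp add: one_pCons eval_at_pCons eval_at_0 L_zero)
  then have "e \<in> range (eval_at e)" by (metis rangeI)
  ultimately show ?thesis using e by auto
qed

text \<open>The kernel is an ideal that is stable under \<open>hw_action \<beta> m\<close>. At a root \<open>r\<close> of a generator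
  \<open>f\<close>, this gives \<open>(r + m \<beta>) f (r - m) = 0\<close> for all \<open>m\<close>.\<close>

lemma inj_eval_at:
  assumes "\<beta> \<noteq> 0"
  shows "inj (eval_at e)"
proof -
  interpret E: Vector_Spaces.linear smult s "eval_at e" by (rule linear_eval_at)
  have "f = 0" if "eval_at e f = 0" for f
  proof (rule ccontr)
    assume "f \<noteq> 0"
    define K where "K f \<longleftrightarrow> f \<noteq> 0 \<and> eval_at e f = 0" for f
    have "K f" using that \<open>f \<noteq> 0\<close> by (simp add: K_def)
    \<comment> \<open>A nonzero kernel element of least degree generates the kernel, by division
      with remainder.\<close>
    then obtain g where g: "K g" and min: "\<And>h. K h \<Longrightarrow> degree g \<le> degree h"
      using ex_has_least_nat[of K f degree] by blast
    have g0: "g \<noteq> 0" "eval_at e g = 0" using g by (simp_all add: K_def)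
    have dvd: "g dvd h" if "eval_at e h = 0" for h
    proof (rule ccontr)
      assume ndvd: "\<not> g dvd h"
      have "eval_at e (h mod g) = eval_at e (h - h div g * g)"
        by (simp add: minus_div_mult_eq_mod)
      also have "\<dots> = 0"
        using eval_at_mult_eq_0[OF g0(2)] that by (simp add: E.diff)
      finally have "K (h mod g)" using ndvd by (simp add: K_def dvd_eq_mod_eq_0)
      then show False using min degree_mod_less_degree[OF g0(1) ndvd] by (simp add: not_le[symmetric])
    qed
    have "degree g \<noteq> 0"
    proof
      assume "degree g = 0"
      then obtain c where c: "g = [:c:]" by (rule degree_eq_zeroE)
      then show False using g0 e by (simp add: eval_at_pCons eval_at_0 L_zero)
    qed
    then obtain r where r: "poly g r = 0"
      using fundamental_theorem_of_algebra[of g] by (auto simp: constant_degree)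
    \<comment> \<open>This is the value of \<open>hw_action \<beta> n g\<close> at \<open>r\<close>,
      written as a polynomial in \<open>n\<close>; it vanishes because \<open>g\<close> divides
      \<open>hw_action \<beta> n g\<close>.\<close>
    have "poly ([:r, \<beta>:] * pcompose g [:r, -1:]) (of_nat n) = 0" for n
    proof -
      have "eval_at e (hw_action \<beta> (int n) g) = 0"
        by (simp add: gen_action_eval_at[symmetric] g0 gen_action_zero)
      then obtain q where "hw_action \<beta> (int n) g = g * q" using dvd by (auto elim: dvdE)
      then have "poly (hw_action \<beta> (int n) g) r = 0" using r by simp
      then show ?thesis by (simp add: hw_action_def poly_pcompose algebra_simps)
    qed
    then have "[:r, \<beta>:] * pcompose g [:r, -1:] = 0" by (rule poly_eq_0_if_zero_on_nats)
    moreover have "pcompose g [:r, -1:] \<noteq> 0"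
      using g0(1) by (simp add: pcompose_eq_0_iff)
    ultimately show False using assms by (simp only: mult_eq_0_iff pCons_eq_0_iff simp_thms)
  qed
  then show ?thesis
    by (intro injI) (metis E.diff eq_iff_diff_eq_0)
qed

end

end

subsection \<open>Isomorphisms\<close>

text \<open>The action of \<open>L_m\<close> with \<open>gen_action\<close> replaced by any family
  \<open>D\<close>, where \<open>D 0\<close> takes the place of \<open>L (-1)\<close>. With
  \<open>hw_action\<close> for \<open>D\<close> it describes the polynomial model without a
  \<open>vir_a\<close>-action on polynomials.\<close>

definition M_op :: "(complex \<Rightarrow> 'v::ab_group_add \<Rightarrow> 'v) \<Rightarrow> (int \<Rightarrow> 'v \<Rightarrow> 'v) \<Rightarrow>
    complex \<Rightarrow> complex \<Rightarrow> complex \<Rightarrow> int \<Rightarrow> 'v poly \<Rightarrow> 'v poly" where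
  "M_op s D \<mu> l \<alpha> m p = tensor_scale s (l powi m) (part1 s (D 0) \<alpha> m p)
    + tensor_scale s ((l * \<mu>) powi m) (part2 s D m p)"

lemma (in C_module) M_L_eq_M_op: "M_L s \<rho> \<mu> l \<alpha> = M_op s (gen_action s \<rho>) \<mu> l \<alpha>"
proof -
  have "gen_action s \<rho> 0 = L (-1)" using gen_action_0 by auto
  then show ?thesis by (intro ext) (simp add: M_op_def M_L_parts[OF vector_space_axioms])
qed

text \<open>One notion for both levels: \<open>D\<close> and \<open>E\<close> may be the series on
  \<open>V1\<close> and \<open>V2\<close> or the operators \<open>L_m\<close> on the tensor
  products.\<close>

definition op_iso :: "(complex \<Rightarrow> 'v::ab_group_add \<Rightarrow> 'v) \<Rightarrow> (int \<Rightarrow> 'v \<Rightarrow> 'v) \<Rightarrow>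
    (complex \<Rightarrow> 'w::ab_group_add \<Rightarrow> 'w) \<Rightarrow> (int \<Rightarrow> 'w \<Rightarrow> 'w) \<Rightarrow> ('v \<Rightarrow> 'w) \<Rightarrow> bool" where
  "op_iso s D t E f \<longleftrightarrow> Vector_Spaces.linear s t f \<and> bij f \<and> (\<forall>m v. f (D m v) = E m (f v))"

lemma op_iso_inv:
  assumes "op_iso s D t E f"
  shows "op_iso t E s D (inv f)"
proof -
  have f: "Vector_Spaces.linear s t f" "bij f" "\<And>m v. f (D m v) = E m (f v)"
    using assms by (auto simp: op_iso_def)
  have eq: "inv f w = v" if "f v = w" for v w
    using that f(2) by (auto simp: bij_is_inj)
  have ff: "f (inv f w) = w" for w using f(2) by (simp add: bij_is_surj surj_f_inv_f)
  show ?thesis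
    unfolding op_iso_def Vector_Spaces.linear_iff
    using f(1) f(2)
    by (auto simp: Vector_Spaces.linear_iff ff f(3) bij_imp_bij_inv intro!: eq)
qed

lemma op_iso_comp:
  assumes "op_iso s D t E f" "op_iso t E r F g"
  shows "op_iso s D r F (g \<circ> f)"
  using assms by (auto simp: op_iso_def Vector_Spaces.linear_iff bij_comp)

text \<open>The construction is functorial in \<open>V\<close>. Injectivity of \<open>f\<close>
  preserves degrees, so the sums over coefficients agree term by term.\<close>

lemma op_iso_map_poly:
  assumes "op_iso s D t E f"
  shows "op_iso (tensor_scale s) (M_op s D \<mu> l \<alpha>) (tensor_scale t) (M_op t E \<mu> l \<alpha>) (map_poly f)"
proof -
  have f: "Vector_Spaces.linear s t f" "bij f" "\<And>m v. f (D m v) = E m (f v)"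
    using assms by (auto simp: op_iso_def)
  interpret f: Vector_Spaces.linear s t f by (rule f)
  have vs: "vector_space s" "vector_space t"
    using f(1) by (simp_all add: Vector_Spaces.linear_iff)
  have inv0: "inv f 0 = 0" using f(2) f.zero by (metis bij_is_inj inv_f_f)
  have "f v \<noteq> 0" if "v \<noteq> 0" for v using that f(2) f.zero by (metis bij_is_inj injD)
  then have deg: "degree (map_poly f p) = degree p" for p by (rule degree_map_poly)
  note coeffs = coeff_map_poly f.zero coeff_tensor[OF vs(1)] coeff_tensor[OF vs(2)]
    coeff_tensor_scale[OF vs(1)] coeff_tensor_scale[OF vs(2)]
  have "Vector_Spaces.linear (tensor_scale s) (tensor_scale t) (map_poly f)"
    by (simp add: Vector_Spaces.linear_iff vector_space_tensor_scale vs poly_eq_iff coeffs f.add f.scale)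
  moreover have "map_poly (inv f) \<circ> map_poly f = id" "map_poly f \<circ> map_poly (inv f) = id"
    using f(2) by (auto simp: fun_eq_iff poly_eq_iff coeff_map_poly f.zero inv0
        bij_is_inj bij_is_surj surj_f_inv_f)
  then have "bij (map_poly f)" by (rule o_bij)
  moreover have "map_poly f (M_op s D \<mu> l \<alpha> m p) = M_op t E \<mu> l \<alpha> m (map_poly f p)" for m p
    by (rule poly_eqI)
      (simp add: M_op_def part1_def part2_def deg coeff_sum coeffs f.sum f.add f.diff f.scale f(3))
  ultimately show ?thesis by (simp add: op_iso_def)
qed

lemma lie_module_iso_if_op_iso:
  assumes "op_iso (tensor_scale s1) (M_L s1 \<rho>1 \<mu>1 l1 \<alpha>1) (tensor_scale s2) (M_L s2 \<rho>2 \<mu>2 l2 \<alpha>2) \<phi>"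
  shows "lie_module_iso UNIV (tensor_scale s1) (M_act s1 \<rho>1 \<mu>1 l1 \<alpha>1)
    (tensor_scale s2) (M_act s2 \<rho>2 \<mu>2 l2 \<alpha>2)"
proof -
  have \<phi>: "Vector_Spaces.linear (tensor_scale s1) (tensor_scale s2) \<phi>" "bij \<phi>"
      "\<And>m p. \<phi> (M_L s1 \<rho>1 \<mu>1 l1 \<alpha>1 m p) = M_L s2 \<rho>2 \<mu>2 l2 \<alpha>2 m (\<phi> p)"
    using assms by (auto simp: op_iso_def)
  interpret \<phi>: Vector_Spaces.linear "tensor_scale s1" "tensor_scale s2" \<phi> by (rule \<phi>)
  have "\<phi> (M_act s1 \<rho>1 \<mu>1 l1 \<alpha>1 x p) = M_act s2 \<rho>2 \<mu>2 l2 \<alpha>2 x (\<phi> p)" for x p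
    by (simp add: M_act_def \<phi>.sum \<phi>.scale \<phi>(3))
  then show ?thesis unfolding lie_module_iso_def using \<phi>(1,2) by blast
qed

lemma op_iso_gen_action:
  assumes "category_C s1 \<rho>1" "category_C s2 \<rho>2"
    and "Vector_Spaces.linear s1 s2 f" "bij f" "\<And>x v. x \<in> vir_a \<Longrightarrow> f (\<rho>1 x v) = \<rho>2 x (f v)"
  shows "op_iso s1 (gen_action s1 \<rho>1) s2 (gen_action s2 \<rho>2) f"
proof -
  interpret V1: C_module s1 \<rho>1 by (rule C_module.intro) (rule assms)
  interpret V2: C_module s2 \<rho>2 by (rule C_module.intro) (rule assms)
  interpret f: Vector_Spaces.linear s1 s2 f by (rule assms)
  have f_L: "f (V1.L (int i - 1) v) = V2.L (int i - 1) (f v)" for i v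
    by (intro assms(5) vir_L_in_vir_a) simp
  have "f (gen_action s1 \<rho>1 m v) = gen_action s2 \<rho>2 m (f v)" for m v
  proof -
    obtain r :: nat where r: "\<forall>i\<ge>int r. V1.L i v = 0" using V1.L_eventually_zero by blast
    have zero: "V1.L (int i - 1) v = 0" if "r + 1 \<le> i" for i
      using r that by simp
    have "V2.L (int i - 1) (f v) = 0" if "r + 1 \<le> i" for i
      using f_L[of i v] zero[OF that] f.zero by simp
    from V2.gen_action_sum[OF this, where m = m] V1.gen_action_sum[OF zero, where m = m]
    show ?thesis by (simp add: f.sum f.scale f_L del: sum.lessThan_Suc)
  qed
  then show ?thesis using assms(3,4) by (simp add: op_iso_def)
qed

section \<open>The polynomial model in two variables and its symmetry\<close>

definition eval2 :: "complex poly poly \<Rightarrow> complex \<Rightarrow> complex \<Rightarrow> complex" where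
  "eval2 F x y = poly (poly F [:y:]) x"

lemma eval2_simps [simp]:
  "eval2 0 x y = 0" "eval2 (pCons f F) x y = poly f x + y * eval2 F x y"
  "eval2 (F + G) x y = eval2 F x y + eval2 G x y" "eval2 (F - G) x y = eval2 F x y - eval2 G x y"
  "eval2 (F * G) x y = eval2 F x y * eval2 G x y" "eval2 (smult f F) x y = poly f x * eval2 F x y"
  by (simp_all add: eval2_def)

lemma eval2_sum: "eval2 (sum F A) x y = (\<Sum>k\<in>A. eval2 (F k) x y)"
  by (induction A rule: infinite_finite_induct) simp_all

text \<open>Over the coefficient ring of polynomials in \<open>x\<close>, the difference has the
  infinitely many roots \<open>[:y:]\<close>. Operator identities can thus be checked on
  values.\<close>

lemma eval2_inject:
  assumes "\<And>x y. eval2 F x y = eval2 G x y"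
  shows "F = G"
proof (rule ccontr)
  assume "F \<noteq> G"
  then have "finite {g. poly (F - G) g = 0}" by (intro poly_roots_finite) simp
  moreover have "range (\<lambda>y. [:y:]) \<subseteq> {g. poly (F - G) g = 0}"
    using assms by (auto simp: eval2_def poly_eq_poly_eq_iff[symmetric])
  ultimately have "finite (range (\<lambda>y :: complex. [:y:]))" by (rule rev_finite_subset)
  then show False using finite_imageD[of "\<lambda>y :: complex. [:y:]" UNIV] infinite_UNIV_char_0
    by (auto simp: inj_on_def)
qed

lemma eval2_tensor: "eval2 (tensor smult f g) x y = poly f x * poly g y"
proof -
  have "eval2 (map_poly (\<lambda>c. smult c f) g) x y = poly f x * poly g y"
    by (induction g) (simp_all add: map_poly_pCons algebra_simps)
  then show ?thesis by (simp add: tensor_def)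
qed

lemma tensor_scale_smult: "tensor_scale smult c F = smult [:c:] F"
  by (rule poly_eqI) (simp add: coeff_tensor_scale[OF vector_space_smult])

lemma eval2_tensor_scale: "eval2 (tensor_scale smult c F) x y = c * eval2 F x y"
  by (simp add: tensor_scale_smult eval2_def)

lemma eval2_eq_sum: "eval2 F x y = (\<Sum>k\<le>degree F. poly (coeff F k) x * y ^ k)"
  by (simp add: eval2_def poly_altdef[of F] poly_sum poly_power)

text \<open>With \<open>y\<close> for \<open>\<partial>\<close> and \<open>x\<close> for
  \<open>L (-1)\<close>, the first exponential part shifts \<open>y\<close> only and the second
  shifts both variables.\<close>

lemma eval2_M_op:
  "eval2 (M_op smult (hw_action \<beta>) \<mu> l \<alpha> m F) x y
    = l powi m * (y - of_int m * \<alpha> - x) * eval2 F x (y - of_int m)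
      + (l * \<mu>) powi m * (x + of_int m * \<beta>) * eval2 F (x - of_int m) (y - of_int m)"
proof -
  have "eval2 (part1 smult (hw_action \<beta> 0) \<alpha> m F) x y
      = (y - of_int m * \<alpha> - x) * eval2 F x (y - of_int m)"
    by (simp add: part1_def eval2_sum eval2_tensor eval2_eq_sum[of F] sum_distrib_left
        poly_power hw_action_def algebra_simps)
  moreover have "eval2 (part2 smult (hw_action \<beta>) m F) x y
      = (x + of_int m * \<beta>) * eval2 F (x - of_int m) (y - of_int m)"
    by (simp add: part2_def eval2_sum eval2_tensor eval2_eq_sum[of F] sum_distrib_left
        poly_power poly_pcompose hw_action_def algebra_simps)
  ultimately show ?thesis by (simp add: M_op_def eval2_tensor_scale)
qed

text \<open>The substitution \<open>F(x, y) \<mapsto> F(y - x, y)\<close>. In the coordinates \<open>x\<close> and \<open>y - x\<close>, the module is a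
  tensor product of two rank one modules, and the substitution swaps its factors.\<close>

definition swap_vars :: "complex poly poly \<Rightarrow> complex poly poly" where
  "swap_vars F = (\<Sum>k\<le>degree F. poly (map_poly (\<lambda>c. [:[:c:]:]) (coeff F k)) [:[:0, -1:], 1:] * monom 1 k)"

lemma eval2_swap_vars: "eval2 (swap_vars F) x y = eval2 F (y - x) y"
proof -
  have "eval2 (poly (map_poly (\<lambda>c. [:[:c:]:]) f) [:[:0, -1:], 1:]) x y = poly f (y - x)" for f
    by (induction f) (simp_all add: map_poly_pCons algebra_simps)
  moreover have "eval2 (monom 1 k) x y = y ^ k" for k
    by (simp add: eval2_def poly_monom poly_power)
  ultimately show ?thesis by (simp add: swap_vars_def eval2_sum eval2_eq_sum[of F])
qed

text \<open>With \<open>z = y - x\<close>, the operator is \<open>l1^m (z - m \<alpha>1)\<close>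
  after a shift of \<open>z\<close> plus \<open>l2^m (x - m \<alpha>2)\<close> after a shift of
  \<open>x\<close>. Exchanging \<open>x\<close> and \<open>z\<close> exchanges the
  parameters.\<close>

lemma op_iso_swap_vars:
  assumes "l2 = l1 * \<mu>1" "l1 = l2 * \<mu>2"
  shows "op_iso (tensor_scale smult) (M_op smult (hw_action (- \<alpha>2)) \<mu>1 l1 \<alpha>1)
    (tensor_scale smult) (M_op smult (hw_action (- \<alpha>1)) \<mu>2 l2 \<alpha>2) swap_vars"
proof -
  have "Vector_Spaces.linear (tensor_scale smult) (tensor_scale smult) swap_vars"
    unfolding Vector_Spaces.linear_iff
    by (auto intro!: eval2_inject vector_space_tensor_scale vector_space_smult
        simp: eval2_swap_vars eval2_tensor_scale)
  moreover have "swap_vars \<circ> swap_vars = id"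
    by (auto intro!: eval2_inject simp: fun_eq_iff eval2_swap_vars)
  then have "bij swap_vars" using o_bij by blast
  moreover have "swap_vars (M_op smult (hw_action (- \<alpha>2)) \<mu>1 l1 \<alpha>1 m F)
      = M_op smult (hw_action (- \<alpha>1)) \<mu>2 l2 \<alpha>2 m (swap_vars F)" for m F
  proof (rule eval2_inject)
    have *: "y - of_int m - (x - of_int m) = y - x" "y - x - of_int m = y - of_int m - x" for x y :: complex
      by simp_all
    show "eval2 (swap_vars (M_op smult (hw_action (- \<alpha>2)) \<mu>1 l1 \<alpha>1 m F)) x y
      = eval2 (M_op smult (hw_action (- \<alpha>1)) \<mu>2 l2 \<alpha>2 m (swap_vars F)) x y" for x y
      unfolding eval2_swap_vars eval2_M_op assms(1)[symmetric] assms(2)[symmetric] *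
      by (simp add: algebra_simps)
  qed
  ultimately show ?thesis by (simp add: op_iso_def)
qed

text \<open>The isomorphism is \<open>eval_at e\<close> for a highest weight vector
  \<open>e\<close>: simplicity makes it onto, and \<open>\<beta> \<noteq> 0\<close> makes it
  injective.\<close>

lemma highest_weight_module_op_iso:
  assumes "simple_module vir_a s \<rho>" "category_C s \<rho>" "highest_weight_module s \<rho> \<beta>" "\<beta> \<noteq> 0"
  shows "\<exists>f. op_iso smult (hw_action \<beta>) s (gen_action s \<rho>) f"
proof -
  interpret C_module s \<rho> by (rule C_module.intro) (rule assms)
  obtain e where e: "e \<noteq> 0" "L 0 e = s \<beta> e" "\<And>i. i \<ge> 1 \<Longrightarrow> L i e = 0"
    using assms(3) by (auto simp: highest_weight_module_def)
  have "bij (eval_at e)"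
    unfolding bij_def using inj_eval_at[OF e assms(4)] surj_eval_at[OF e assms(1)] ..
  then have "op_iso smult (hw_action \<beta>) s (gen_action s \<rho>) (eval_at e)"
    by (simp add: op_iso_def linear_eval_at gen_action_eval_at[OF e])
  then show ?thesis by blast
qed

lemma M_hom_op_iso:
  assumes "category_C s1 \<rho>1" "category_C s2 \<rho>2"
    and "l1 \<noteq> 0" "\<mu>1 \<noteq> 0" "\<mu>1 \<noteq> 1" "l2 \<noteq> 0" "\<alpha>2 \<noteq> 0" "\<mu>2 \<noteq> 0" "\<mu>2 \<noteq> 1"
    and "op_iso (tensor_scale s1) (M_L s1 \<rho>1 \<mu>1 l1 \<alpha>1) (tensor_scale s2) (M_L s2 \<rho>2 \<mu>2 l2 \<alpha>2) \<phi>"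
  shows "M_hom s1 \<rho>1 s2 \<rho>2 \<mu>1 l1 \<alpha>1 \<mu>2 l2 \<alpha>2 \<phi>"
  using assms by (intro M_hom.intro M_hom_axioms.intro C_module.intro) (auto simp: op_iso_def bij_is_inj)

theorem theorem4p2:
  fixes s1 :: "complex \<Rightarrow> 'v::ab_group_add \<Rightarrow> 'v" and \<rho>1 :: "vir \<Rightarrow> 'v \<Rightarrow> 'v"
    and s2 :: "complex \<Rightarrow> 'w::ab_group_add \<Rightarrow> 'w" and \<rho>2 :: "vir \<Rightarrow> 'w \<Rightarrow> 'w"
    and \<mu>1 \<mu>2 l1 l2 \<alpha>1 \<alpha>2 :: complex
  assumes "l1 \<noteq> 0" "\<alpha>1 \<noteq> 0" "\<mu>1 \<noteq> 0" "\<mu>1 \<noteq> 1"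
    and "l2 \<noteq> 0" "\<alpha>2 \<noteq> 0" "\<mu>2 \<noteq> 0" "\<mu>2 \<noteq> 1"
    and "simple_module vir_a s1 \<rho>1" "category_C s1 \<rho>1"
    and "simple_module vir_a s2 \<rho>2" "category_C s2 \<rho>2"
  shows "lie_module_iso UNIV (tensor_scale s1) (M_act s1 \<rho>1 \<mu>1 l1 \<alpha>1)
           (tensor_scale s2) (M_act s2 \<rho>2 \<mu>2 l2 \<alpha>2) \<longleftrightarrow>
         ((\<mu>1, l1, \<alpha>1) = (\<mu>2, l2, \<alpha>2) \<and> lie_module_iso vir_a s1 \<rho>1 s2 \<rho>2) \<or>
         (\<mu>1 = inverse \<mu>2 \<and> inverse \<mu>2 = l2 / l1 \<and>
           highest_weight_module s1 \<rho>1 (- \<alpha>2) \<and> highest_weight_module s2 \<rho>2 (- \<alpha>1))"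
    (is "?iso \<longleftrightarrow> ?a \<or> ?b")
proof
  interpret V1: C_module s1 \<rho>1 by (rule C_module.intro) (rule assms)
  interpret V2: C_module s2 \<rho>2 by (rule C_module.intro) (rule assms)
  {
    assume ?iso
    then obtain \<phi> where \<phi>: "Vector_Spaces.linear (tensor_scale s1) (tensor_scale s2) \<phi>" "bij \<phi>"
        "\<And>x v. \<phi> (M_act s1 \<rho>1 \<mu>1 l1 \<alpha>1 x v) = M_act s2 \<rho>2 \<mu>2 l2 \<alpha>2 x (\<phi> v)"
      unfolding lie_module_iso_def by blast
    have iso: "op_iso (tensor_scale s1) (M_L s1 \<rho>1 \<mu>1 l1 \<alpha>1) (tensor_scale s2) (M_L s2 \<rho>2 \<mu>2 l2 \<alpha>2) \<phi>"
      using \<phi>(1,2) \<phi>(3)[of "vir_L _"]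
      by (simp add: op_iso_def M_act_L[OF V1.vector_space_axioms] M_act_L[OF V2.vector_space_axioms])
    interpret h: M_hom s1 \<rho>1 s2 \<rho>2 \<mu>1 l1 \<alpha>1 \<mu>2 l2 \<alpha>2 \<phi>
      using assms iso by (intro M_hom_op_iso)
    \<comment> \<open>The inverse satisfies the same hypotheses with the indices exchanged.\<close>
    interpret h': M_hom s2 \<rho>2 s1 \<rho>1 \<mu>2 l2 \<alpha>2 \<mu>1 l1 \<alpha>1 "inv \<phi>"
      using assms op_iso_inv[OF iso] by (intro M_hom_op_iso)
    from h.exponentials_match show "?a \<or> ?b"
    proof
      assume same: "l1 = l2 \<and> \<mu>1 = \<mu>2"
      then have same1: "l1 = l2" "\<mu>1 = \<mu>2" and same2: "l2 = l1" "\<mu>2 = \<mu>1" by simp_all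
      \<comment> \<open>Both maps preserve constants, so the restrictions of \<open>\<phi>\<close>
        and \<open>inv \<phi>\<close> are mutually inverse.\<close>
      have "h'.restriction (h.restriction v) = v" for v
        using h.\<phi>_const[OF same1, of v] h'.\<phi>_const[OF same2, of "h.restriction v"] \<phi>(2)
        by (metis bij_is_inj inv_f_f pCons_eq_iff)
      moreover have "h.restriction (h'.restriction w) = w" for w
        using h'.\<phi>_const[OF same2, of w] h.\<phi>_const[OF same1, of "h'.restriction w"] \<phi>(2)
        by (metis bij_is_surj surj_f_inv_f pCons_eq_iff)
      ultimately have "bij h.restriction"
        by (intro o_bij[of h'.restriction]) (simp_all add: fun_eq_iff)
      then have "lie_module_iso vir_a s1 \<rho>1 s2 \<rho>2"
        unfolding lie_module_iso_def
        using h.linear_restriction[OF same1] h.restriction_action[OF same1] by blast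
      with h.same_\<alpha>[OF same1] same show ?thesis by simp
    next
      assume swap: "l1 = l2 * \<mu>2 \<and> l2 = l1 * \<mu>1"
      obtain w where "w \<noteq> 0" "V2.L 0 w = s2 (- \<alpha>1) w" "\<And>i. i \<ge> 1 \<Longrightarrow> V2.L i w = 0"
        using h.swapped_highest_weight_vector swap by blast
      then have "highest_weight_module s2 \<rho>2 (- \<alpha>1)"
        using assms by (intro V2.highest_weight_module_if_simple)
      \<comment> \<open>The highest weight vector of \<open>V1\<close> comes from the inverse
        map.\<close>
      moreover obtain v where "v \<noteq> 0" "V1.L 0 v = s1 (- \<alpha>2) v" "\<And>i. i \<ge> 1 \<Longrightarrow> V1.L i v = 0"
        using h'.swapped_highest_weight_vector swap by blast
      then have "highest_weight_module s1 \<rho>1 (- \<alpha>2)"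
        using assms by (intro V1.highest_weight_module_if_simple)
      moreover have "\<mu>1 = l2 / l1" using assms(1) by (simp add: conjunct2[OF swap])
      moreover have "inverse \<mu>2 = l2 / l1" using assms(5,7) by (simp add: conjunct1[OF swap] field_simps)
      ultimately show ?thesis by simp
    qed
  }
  assume "?a \<or> ?b"
  then show ?iso
  proof
    assume a: ?a
    then obtain f where f: "Vector_Spaces.linear s1 s2 f" "bij f"
        "\<And>x v. x \<in> vir_a \<Longrightarrow> f (\<rho>1 x v) = \<rho>2 x (f v)"
      unfolding lie_module_iso_def by blast
    from a have eqs: "\<mu>1 = \<mu>2" "l1 = l2" "\<alpha>1 = \<alpha>2" by blast+
    show ?iso
      unfolding eqs
      by (rule lie_module_iso_if_op_iso, unfold V1.M_L_eq_M_op V2.M_L_eq_M_op,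
          rule op_iso_map_poly, rule op_iso_gen_action) (fact assms f)+
  next
    assume b: ?b
    then have \<mu>: "\<mu>1 = inverse \<mu>2" "inverse \<mu>2 = l2 / l1" by blast+
    have l2: "l2 = l1 * \<mu>1" unfolding \<mu> using assms(1) by simp
    have l1: "l1 = l2 * \<mu>2" unfolding l2 \<mu>(1) using assms(7) by simp
    note swap = op_iso_swap_vars[OF l2 l1, of \<alpha>2 \<alpha>1]
    obtain f g where "op_iso smult (hw_action (- \<alpha>2)) s1 (gen_action s1 \<rho>1) f"
        and "op_iso smult (hw_action (- \<alpha>1)) s2 (gen_action s2 \<rho>2) g"
      using highest_weight_module_op_iso[OF assms(9,10)] highest_weight_module_op_iso[OF assms(11,12)]
        b assms(2,6) by (metis neg_equal_0_iff_equal)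
    \<comment> \<open>From the first module to the polynomial model of \<open>V1\<close>, by the
      swap to that of \<open>V2\<close>, and on to the second module.\<close>
    from op_iso_comp[OF op_iso_comp[OF op_iso_inv[OF op_iso_map_poly[OF this(1)]] swap]
        op_iso_map_poly[OF this(2)], folded V1.M_L_eq_M_op V2.M_L_eq_M_op]
    show ?iso by (rule lie_module_iso_if_op_iso)
  qed
qed

end
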